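(* Let $\Pi, \Gamma, \Sigma, Q$ be contexts such that $\Pi; \Gamma; \Sigma; Q \vdash (M \mid V \mid \Omega \mid \rho)$, and suppose $(M \mid V \mid \Omega \mid \rho) \leadsto (M' \mid V' \mid \Omega' \mid \rho')$. Then there exist (necessarily unique) contexts $\Pi', \Gamma', Q'$ such that $\Pi'; \Gamma'; \Sigma; Q' \vdash (M' \mid V' \mid \Omega' \mid \rho')$; in particular the output variable context $\Sigma$ is the same before and after the reduction.
   Context: This concerns the quantum programming language QPL with inductive types. Types: $A,B ::= X \mid I \mid \mathbf{qbit} \mid A+B \mid A\otimes B \mid \mu X.A$ ($X$ type variables). A type context $\Theta$ is a list of distinct type variables; $\Theta \vdash A$ is derivable by: $\Theta\vdash X$ for $X$ in $\Theta$; $\Theta \vdash I$; $\Theta\vdash \mathbf{qbit}$; closure under $+$ and $\otimes$; if $\Theta, X \vdash A$ then $\Theta \vdash \mu X.A$. Closed types are those with $\cdot \vdash A$. Classical types are generated by $P,R ::= X \mid I \mid P+R \mid P\otimes R \mid \mu X.P$. $\mathbf{bit} := I+I$. $A[B/X]$ is substitution. Terms: $M,N ::= \mathbf{new\ unit}\ u \mid \mathbf{discard}\ x \mid y = \mathbf{copy}\ x \mid \mathbf{new\ qbit}\ q \mid b = \mathbf{measure}\ q \mid q_1,\dots,q_n \mathrel{*}= S \mid M;N \mid \mathbf{skip} \mid \mathbf{while}\ b\ \mathbf{do}\ M \mid y = \mathbf{left}_{A,B}\, x \mid y = \mathbf{right}_{A,B}\, x \mid \mathbf{case}\ y\ \mathbf{of}\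 \{\mathbf{left}\ x_1 \to M \mid \mathbf{right}\ x_2 \to N\} \mid x = (x_1,x_2) \mid (x_1,x_2) = x \mid y = \mathbf{fold}_{\mu X.A}\, x \mid y = \mathbf{unfold}\ x \mid \mathbf{proc}\ f :: x:A \to y:B\ \{M\} \mid y = f(x)$, where $S$ ranges over unitary $2^n\times 2^n$ matrices (of arity $n$) and $f$ over procedure names. A variable context $\Gamma,\Sigma$ is a finite map from term variables to closed types, written $x_1:A_1,\dots,x_n:A_n$; writing $\Gamma, x:A$ presupposes $x \notin \mathrm{dom}\,\Gamma$. A procedure context $\Pi$ is a finite map from procedure names to pairs of closed types, written $f_1:A_1\to B_1,\dots$. The judgement $\Pi \vdash \langle \Gamma\rangle\ M\ \langle \Sigma\rangle$ is derivable by the rules (all types closed): $\langle\Gamma\rangle\ \mathbf{new\ unit}\ u\ \langle \Gamma, u:I\rangle$; $\langle \Gamma, x:A\rangle\ \mathbf{discard}\ x\ \langle\Gamma\rangle$; for classical $P$: $\langle\Gamma, x:P\rangle\ y=\mathbf{copy}\ x\ \langle \Gamma, x:P, y:P\rangle$; $\langle\Gamma\rangle\ \mathbf{skip}\ \langle\Gamma\rangle$; if $\Pi\vdash\langle\Gamma\rangle M\langle\Gamma'\rangle$ and $\Pi\vdash\langle\Gamma'\rangle N\langle\Sigma\rangle$ then $\Pi\vdash\langle\Gamma\rangle M;N\langle\Sigma\rangle$; if $\Pi \vdash \langle\Gamma, b:\mathbf{bit}\rangle M \langle \Gamma, b:\mathbf{bit}\rangle$ then $\Pi\vdash\langle\Gamma,b:\mathbf{bit}\rangle\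 \mathbf{while}\ b\ \mathbf{do}\ M\ \langle\Gamma,b:\mathbf{bit}\rangle$; $\langle\Gamma\rangle\ \mathbf{new\ qbit}\ q\ \langle\Gamma,q:\mathbf{qbit}\rangle$; $\langle\Gamma,q:\mathbf{qbit}\rangle\ b=\mathbf{measure}\ q\ \langle\Gamma,b:\mathbf{bit}\rangle$; for $S$ of arity $n$: $\langle\Gamma,q_1:\mathbf{qbit},\dots,q_n:\mathbf{qbit}\rangle\ q_1,\dots,q_n\mathrel{*}=S\ \langle\Gamma,q_1:\mathbf{qbit},\dots,q_n:\mathbf{qbit}\rangle$; $\langle\Gamma,x:A\rangle\ y=\mathbf{left}_{A,B}\,x\ \langle\Gamma,y:A+B\rangle$; $\langle\Gamma,x:B\rangle\ y=\mathbf{right}_{A,B}\,x\ \langle\Gamma,y:A+B\rangle$; if $\Pi\vdash\langle\Gamma,x_1:A\rangle M_1\langle\Sigma\rangle$ and $\Pi\vdash\langle\Gamma,x_2:B\rangle M_2\langle\Sigma\rangle$ then $\Pi\vdash\langle\Gamma,y:A+B\rangle\ \mathbf{case}\ y\ \mathbf{of}\ \{\mathbf{left}\ x_1\to M_1\mid \mathbf{right}\ x_2\to M_2\}\ \langle\Sigma\rangle$; $\langle\Gamma,x_1:A,x_2:B\rangle\ x=(x_1,x_2)\ \langle\Gamma,x:A\otimes B\rangle$; $\langle\Gamma,x:A\otimes B\rangle\ (x_1,x_2)=x\ \langle\Gamma,x_1:A,x_2:B\rangle$; $\langle\Gamma,x:A[\mu X.A/X]\rangle\ y=\mathbf{fold}_{\mu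 X.A}\,x\ \langle\Gamma,y:\mu X.A\rangle$; $\langle\Gamma,x:\mu X.A\rangle\ y=\mathbf{unfold}\ x\ \langle\Gamma,y:A[\mu X.A/X]\rangle$; if $\Pi,f:A\to B\vdash\langle x:A\rangle M\langle y:B\rangle$ then $\Pi\vdash\langle\Gamma\rangle\ \mathbf{proc}\ f::x:A\to y:B\ \{M\}\ \langle\Gamma\rangle$; $\Pi,f:A\to B\vdash\langle\Gamma,x:A\rangle\ y=f(x)\ \langle\Gamma,y:B\rangle$. (Rules without premises hold for every $\Pi$.) Values: $v,w ::= * \mid n \mid \mathbf{left}_{A,B}\,v \mid \mathbf{right}_{A,B}\,v \mid (v,w)\mid \mathbf{fold}_{\mu X.A}\,v$, $n\in\mathbb N$; $\mathtt{ff}:=\mathbf{left}_{I,I}*$, $\mathtt{tt}:=\mathbf{right}_{I,I}*$. A qubit pointer context is a finite $Q\subseteq\mathbb N$; $Q\vdash v:A$ is derivable by: $\varnothing\vdash *:I$; $\{n\}\vdash n:\mathbf{qbit}$; $Q\vdash v:A \Rightarrow Q\vdash\mathbf{left}_{A,B}v:A+B$; $Q\vdash v:B\Rightarrow Q\vdash\mathbf{right}_{A,B}v:A+B$; $Q_1\vdash v:A$, $Q_2\vdash w:B$, $Q_1\cap Q_2=\varnothing\Rightarrow Q_1\cup Q_2\vdash(v,w):A\otimes B$; $Q\vdash v:A[\mu X.A/X]\Rightarrow Q\vdash\mathbf{fold}_{\mu X.A}v:\mu X.A$. A value assignment $V=\{x_1=v_1,\dots,x_n=v_n\}$ is a finite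 map from variables to values; $Q;\Gamma\vdash V$ iff $\mathrm{dom}\,V=\mathrm{dom}\,\Gamma$ and $Q$ is a disjoint union $Q_1\cup\dots\cup Q_n$ with $Q_i\vdash v_i:\Gamma(x_i)$. A procedure store $\Omega$ is a finite set of definitions $f::x:A\to y:B\ \{M\}$; $\Pi\vdash\Omega$ is derivable by $\cdot\vdash\cdot$ and: if $\Pi\vdash\Omega$ and $\Pi,f:A\to B\vdash\langle x:A\rangle M\langle y:B\rangle$ then $\Pi,f:A\to B\vdash\Omega, f::x:A\to y:B\ \{M\}$. A configuration is $(M\mid V\mid\Omega\mid\rho)$ with $M$ a term, $V$ a value assignment, $\Omega$ a procedure store and $\rho\in\mathbb C^{2^n\times 2^n}$ ($n\ge 0$, $\dim(\rho):=n$) a positive semidefinite matrix with $0\le\mathrm{tr}\,\rho\le 1$, whose tensor factors $\mathbb C^2$ are numbered $1,\dots,n$ (qubits). We write $\Pi;\Gamma;\Sigma;Q\vdash(M\mid V\mid\Omega\mid\rho)$ iff $\Pi\vdash\langle\Gamma\rangle M\langle\Sigma\rangle$, $Q;\Gamma\vdash V$, $\Pi\vdash\Omega$ and $Q=\{1,\dots,\dim(\rho)\}$. Reduction $\leadsto$ (writing $V, x=v$ for the extension of $V$ by $x\notin\mathrm{dom}V$): (unit) $(\mathbf{new\ unit}\ u\mid V\mid\Omega\mid\rho)\leadsto(\mathbf{skip}\mid V,u=*\mid\Omega\mid\rho)$; (discard) $(\mathbf{discard}\ x\mid V,x=v\mid\Omega\mid\rho)\leadsto(\mathbf{skip}\mid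 r_v(V)\mid\Omega\mid tr_v(\rho))$; (copy) $(y=\mathbf{copy}\ x\mid V,x=v\mid\Omega\mid\rho)\leadsto(\mathbf{skip}\mid V,x=v,y=v\mid\Omega\mid\rho)$; (qbit) $(\mathbf{new\ qbit}\ q\mid V\mid\Omega\mid\rho)\leadsto(\mathbf{skip}\mid V,q=\dim(\rho)+1\mid\Omega\mid\rho\otimes|0\rangle\langle0|)$; (unitary) $(\vec q\mathrel{*}=S\mid V,\vec q=\vec m\mid\Omega\mid\rho)\leadsto(\mathbf{skip}\mid V,\vec q=\vec m\mid\Omega\mid S_{\vec m}(\rho))$; (measure$i$), $i\in\{0,1\}$: $(b=\mathbf{measure}\ q\mid V,q=m\mid\Omega\mid\rho)\leadsto(\mathbf{skip}\mid r_m(V),b=\beta_i\mid\Omega\mid{}_m\langle i|\rho|i\rangle_m)$ with $\beta_0=\mathtt{ff}$, $\beta_1=\mathtt{tt}$; (seq1) $(\mathbf{skip};N\mid V\mid\Omega\mid\rho)\leadsto(N\mid V\mid\Omega\mid\rho)$; (seq2) if $(M\mid V\mid\Omega\mid\rho)\leadsto(M'\mid V'\mid\Omega'\mid\rho')$ then $(M;N\mid V\mid\Omega\mid\rho)\leadsto(M';N\mid V'\mid\Omega'\mid\rho')$; (while) $(\mathbf{while}\ b\ \mathbf{do}\ M\mid V,b=v\mid\Omega\mid\rho)\leadsto(\mathbf{if}\ b\ \mathbf{then}\ \{M;\mathbf{while}\ b\ \mathbf{do}\ M\}\mid V,b=v\mid\Omega\mid\rho)$, where $\mathbf{if}\ b\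 \mathbf{then}\ \{N\}$ abbreviates $\mathbf{case}\ b\ \mathbf{of}\ \{\mathbf{left}\ u\to b=\mathbf{left}_{I,I}\,u\mid\mathbf{right}\ u\to b=\mathbf{right}_{I,I}\,u;N\}$; (left) $(y=\mathbf{left}\ x\mid V,x=v\mid\Omega\mid\rho)\leadsto(\mathbf{skip}\mid V,y=\mathbf{left}\ v\mid\Omega\mid\rho)$ and similarly (right); (caseLeft) $(\mathbf{case}\ y\ \mathbf{of}\ \{\mathbf{left}\ x_1\to M_1\mid\mathbf{right}\ x_2\to M_2\}\mid V,y=\mathbf{left}\ v\mid\Omega\mid\rho)\leadsto(M_1\mid V,x_1=v\mid\Omega\mid\rho)$ and (caseRight) symmetrically to $(M_2\mid V,x_2=v\mid\Omega\mid\rho)$; (pair) $(x=(x_1,x_2)\mid V,x_1=v_1,x_2=v_2\mid\Omega\mid\rho)\leadsto(\mathbf{skip}\mid V,x=(v_1,v_2)\mid\Omega\mid\rho)$; (unpair) the converse; (fold) $(y=\mathbf{fold}\ x\mid V,x=v\mid\Omega\mid\rho)\leadsto(\mathbf{skip}\mid V,y=\mathbf{fold}\ v\mid\Omega\mid\rho)$; (unfold) $(y=\mathbf{unfold}\ x\mid V,x=\mathbf{fold}\ v\mid\Omega\mid\rho)\leadsto(\mathbf{skip}\mid V,y=v\mid\Omega\mid\rho)$; (proc) $(\mathbf{proc}\ f::x:A\to y:B\ \{M\}\mid V\mid\Omega\mid\rho)\leadsto(\mathbf{skip}\mid V\mid\Omega,f::x:A\to y:B\ \{M\}\mid\rho)$;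 (call) $(y_1=f(x_1)\mid V,x_1=v\mid\Omega,f::x_2:A\to y_2:B\ \{M\}\mid\rho)\leadsto(M_\alpha\mid V,x_1=v\mid\Omega,f::x_2:A\to y_2:B\ \{M\}\mid\rho)$, where $M_\alpha$ is obtained from $M$ by renaming $x_2$ to $x_1$, $y_2$ to $y_1$ and all other variables of $M$ to fresh names. Here, for a value $v$ with $Q_v\vdash v:A$: $tr_v(\rho)$ is the partial trace of $\rho$ over the qubits in $Q_v$; $r_v(V)$ replaces each value $w$ of $V$ by $r'_v(w)$, where $r'_v$ maps each pointer $k$ to $k-|\{i\in Q_v: i<k\}|$ and acts homomorphically on $*$, $\mathbf{left}$, $\mathbf{right}$, pairs and $\mathbf{fold}$ (for (measure), $v=m$, $Q_v=\{m\}$); $S_{\vec m}(\rho)=U\rho U^\dagger$ where $U$ acts as $S$ on qubits $m_1,\dots,m_n$ (in this order) and as identity on the others; $|i\rangle_m=I_{2^{m-1}}\otimes|i\rangle\otimes I_{2^{N-m}}$ with $N=\dim(\rho)$ and ${}_m\langle i|$ its adjoint.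
   Formalization: In (call) the renaming of M is injective, so x = f(x) steps only if parameter and result names of f coincide; a store defines each procedure name at most once and (proc) steps only if f is new in Ω; in typing proc, f may shadow an entry of Π. *)

theory Defs
  imports "Jordan_Normal_Form.Schur_Decomposition"
begin

text \<open>Type variables are de Bruijn indices, so that equality of types is equality up to renaming of
  bound type variables.  A type context is then just the number of type variables in scope.\<close>

datatype ty =
    TVar nat
  | One
  | Qbit
  | Sum ty ty
  | Tensor ty ty
  | Mu ty

abbreviation bit_ty :: ty where
  "bit_ty \<equiv> Sum One One"

fun wf_ty :: "nat \<Rightarrow> ty \<Rightarrow> bool" where
  "wf_ty n (TVar i) \<longleftrightarrow> i < n"
| "wf_ty n One \<longleftrightarrow> True"
| "wf_ty n Qbit \<longleftrightarrow> True"
| "wf_ty n (Sum A B) \<longleftrightarrow> wf_ty n A \<and> wf_ty n B"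
| "wf_ty n (Tensor A B) \<longleftrightarrow> wf_ty n A \<and> wf_ty n B"
| "wf_ty n (Mu A) \<longleftrightarrow> wf_ty (Suc n) A"

abbreviation closed_ty :: "ty \<Rightarrow> bool" where
  "closed_ty \<equiv> wf_ty 0"

fun classical :: "ty \<Rightarrow> bool" where
  "classical (TVar i) \<longleftrightarrow> True"
| "classical One \<longleftrightarrow> True"
| "classical Qbit \<longleftrightarrow> False"
| "classical (Sum A B) \<longleftrightarrow> classical A \<and> classical B"
| "classical (Tensor A B) \<longleftrightarrow> classical A \<and> classical B"
| "classical (Mu A) \<longleftrightarrow> classical A"

fun lift_ty :: "nat \<Rightarrow> ty \<Rightarrow> ty" where
  "lift_ty k (TVar i) = TVar (if i < k then i else Suc i)"
| "lift_ty k One = One"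
| "lift_ty k Qbit = Qbit"
| "lift_ty k (Sum A B) = Sum (lift_ty k A) (lift_ty k B)"
| "lift_ty k (Tensor A B) = Tensor (lift_ty k A) (lift_ty k B)"
| "lift_ty k (Mu A) = Mu (lift_ty (Suc k) A)"

text \<open>\<open>subst_ty A k B\<close> replaces the variable \<open>k\<close> in \<open>A\<close> by \<open>B\<close>.  The type \<open>A[\<mu>X.A/X]\<close> is
  \<open>unroll A\<close>, where \<open>A\<close> is the body of the recursive type \<open>Mu A\<close>.\<close>

fun subst_ty :: "ty \<Rightarrow> nat \<Rightarrow> ty \<Rightarrow> ty" where
  "subst_ty (TVar i) k B = (if i < k then TVar i else if i = k then B else TVar (i - 1))"
| "subst_ty One k B = One"
| "subst_ty Qbit k B = Qbit"
| "subst_ty (Sum A1 A2) k B = Sum (subst_ty A1 k B) (subst_ty A2 k B)"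
| "subst_ty (Tensor A1 A2) k B = Tensor (subst_ty A1 k B) (subst_ty A2 k B)"
| "subst_ty (Mu A) k B = Mu (subst_ty A (Suc k) (lift_ty 0 B))"

definition unroll :: "ty \<Rightarrow> ty" where
  "unroll A = subst_ty A 0 (Mu A)"

definition mat_trace :: "complex mat \<Rightarrow> complex" where
  "mat_trace A = (\<Sum>i<dim_row A. A $$ (i, i))"

text \<open>The order on \<open>complex\<close> compares real parts and requires equal imaginary parts.  In
  particular \<open>0 \<le> z\<close> says that \<open>z\<close> is real and nonnegative.\<close>

definition psd :: "complex mat \<Rightarrow> bool" where
  "psd A \<longleftrightarrow> square_mat A \<and> (\<forall>v \<in> carrier_vec (dim_row A). 0 \<le> (A *\<^sub>v v) \<bullet>c v)"

definition unitary_mat :: "nat \<Rightarrow> complex mat \<Rightarrow> bool" where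
  "unitary_mat d S \<longleftrightarrow> S \<in> carrier_mat d d
     \<and> mat_adjoint S * S = 1\<^sub>m d \<and> S * mat_adjoint S = 1\<^sub>m d"

definition kron :: "complex mat \<Rightarrow> complex mat \<Rightarrow> complex mat" where
  "kron A B = mat (dim_row A * dim_row B) (dim_col A * dim_col B)
     (\<lambda>(i, j). A $$ (i div dim_row B, j div dim_col B) * B $$ (i mod dim_row B, j mod dim_col B))"

definition qdim :: "complex mat \<Rightarrow> nat" where
  "qdim \<rho> = (THE n. dim_row \<rho> = 2 ^ n)"

definition qstate :: "complex mat \<Rightarrow> bool" where
  "qstate \<rho> \<longleftrightarrow> (\<exists>n. \<rho> \<in> carrier_mat (2 ^ n) (2 ^ n)) \<and> psd \<rho> \<and> 0 \<le> mat_trace \<rho> \<and> mat_trace \<rho> \<le> 1"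

definition ket :: "nat \<Rightarrow> complex mat" where
  "ket i = mat 2 1 (\<lambda>(r, c). if r = i then 1 else 0)"

text \<open>\<open>ket_at N m i\<close> is \<open>|i\<rangle>\<^sub>m\<close> on \<open>N\<close> qubits, numbered from \<open>1\<close>.\<close>

definition ket_at :: "nat \<Rightarrow> nat \<Rightarrow> nat \<Rightarrow> complex mat" where
  "ket_at N m i = kron (kron (1\<^sub>m (2 ^ (m - 1))) (ket i)) (1\<^sub>m (2 ^ (N - m)))"

definition project :: "nat \<Rightarrow> nat \<Rightarrow> complex mat \<Rightarrow> complex mat" where
  "project m i \<rho> = mat_adjoint (ket_at (qdim \<rho>) m i) * \<rho> * ket_at (qdim \<rho>) m i"

definition add_qubit :: "complex mat \<Rightarrow> complex mat" where
  "add_qubit \<rho> = kron \<rho> (ket 0 * mat_adjoint (ket 0))"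

text \<open>The partial trace over a set of qubits is the composition of the partial traces over its
  elements.  The largest qubit is traced out first, so that the numbers of the
  qubits that remain to be traced out do not shift.\<close>

definition ptrace1 :: "nat \<Rightarrow> complex mat \<Rightarrow> complex mat" where
  "ptrace1 m \<rho> = project m 0 \<rho> + project m 1 \<rho>"

definition ptrace :: "nat set \<Rightarrow> complex mat \<Rightarrow> complex mat" where
  "ptrace Q \<rho> = foldr ptrace1 (sorted_list_of_set Q) \<rho>"

text \<open>Qubit \<open>1\<close> is the leftmost tensor factor, so the value of qubit \<open>m\<close> in the basis vector with
  index \<open>i < 2 ^ N\<close> is the binary digit of \<open>i\<close> of weight \<open>2 ^ (N - m)\<close>.  \<open>select N ms i\<close> is the index
  of the basis vector of the qubits \<open>ms\<close>, the head of \<open>ms\<close> being the leftmost factor.\<close>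

definition qubit_of :: "nat \<Rightarrow> nat \<Rightarrow> nat \<Rightarrow> bool" where
  "qubit_of N i m = bit i (N - m)"

definition select :: "nat \<Rightarrow> nat list \<Rightarrow> nat \<Rightarrow> nat" where
  "select N ms i = horner_sum of_bool 2 (rev (map (qubit_of N i) ms))"

definition gate_at :: "nat \<Rightarrow> nat list \<Rightarrow> complex mat \<Rightarrow> complex mat" where
  "gate_at N ms S = mat (2 ^ N) (2 ^ N) (\<lambda>(i, j).
     if \<forall>m \<in> {1..N} - set ms. qubit_of N i m = qubit_of N j m
     then S $$ (select N ms i, select N ms j) else 0)"

definition apply_gate :: "nat list \<Rightarrow> complex mat \<Rightarrow> complex mat \<Rightarrow> complex mat" where
  "apply_gate ms S \<rho> = gate_at (qdim \<rho>) ms S * \<rho> * mat_adjoint (gate_at (qdim \<rho>) ms S)"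

type_synonym var = nat
type_synonym pname = nat

text \<open>\<open>vars M\<close> collects all term variables occurring in \<open>M\<close>, the parameters and bodies of
  procedure definitions and the pattern variables of case distinctions included; \<open>rename\<close> acts on
  all of them.  \<open>Fold A y x\<close> is the term \<open>y = fold\<^bsub>\<mu>X.A\<^esub> x\<close>.\<close>

datatype (vars: 'x) tm =
    NewUnit 'x
  | Discard 'x
  | Copy 'x 'x                      \<comment> \<open>\<open>y = copy x\<close>\<close>
  | NewQbit 'x
  | Measure 'x 'x                   \<comment> \<open>\<open>b = measure q\<close>\<close>
  | Gate "'x list" "complex mat"
  | Seq "'x tm" "'x tm"
  | Skip
  | While 'x "'x tm"
  | Left ty ty 'x 'x                \<comment> \<open>\<open>y = left\<^bsub>A,B\<^esub> x\<close>\<close>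
  | Right ty ty 'x 'x
  | Case 'x 'x "'x tm" 'x "'x tm"   \<comment> \<open>\<open>case y of {left x\<^sub>1 \<rightarrow> M | right x\<^sub>2 \<rightarrow> N}\<close>\<close>
  | Pair 'x 'x 'x                   \<comment> \<open>\<open>x = (x\<^sub>1, x\<^sub>2)\<close>\<close>
  | Unpair 'x 'x 'x                 \<comment> \<open>\<open>(x\<^sub>1, x\<^sub>2) = x\<close>\<close>
  | Fold ty 'x 'x
  | Unfold 'x 'x
  | Proc pname 'x ty 'x ty "'x tm"  \<comment> \<open>\<open>proc f :: x : A \<rightarrow> y : B {M}\<close>\<close>
  | Call 'x pname 'x                \<comment> \<open>\<open>y = f(x)\<close>\<close>
  for map: rename

type_synonym vctx = "var \<rightharpoonup> ty"
type_synonym pctx = "pname \<rightharpoonup> ty \<times> ty"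

definition wf_vctx :: "vctx \<Rightarrow> bool" where
  "wf_vctx \<Gamma> \<longleftrightarrow> finite (dom \<Gamma>) \<and> (\<forall>A \<in> ran \<Gamma>. closed_ty A)"

definition wf_pctx :: "pctx \<Rightarrow> bool" where
  "wf_pctx \<Phi> \<longleftrightarrow> finite (dom \<Phi>) \<and> (\<forall>(A, B) \<in> ran \<Phi>. closed_ty A \<and> closed_ty B)"

definition wf_ctxs :: "pctx \<Rightarrow> vctx \<Rightarrow> bool" where
  "wf_ctxs \<Phi> \<Gamma> \<longleftrightarrow> wf_pctx \<Phi> \<and> wf_vctx \<Gamma>"

text \<open>\<open>typing \<Phi> \<Gamma> M \<Sigma>\<close> is the judgement \<open>\<Phi> \<turnstile> \<langle>\<Gamma>\<rangle> M \<langle>\<Sigma>\<rangle>\<close>.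

  A variable context \<open>\<Gamma>, x : A\<close> presupposes \<open>x \<notin> dom \<Gamma>\<close>.  No such requirement is made for
  procedure contexts: in rule \<open>Proc\<close>, whose \<open>f\<close> is in scope only in the body, an assumption on \<open>f\<close>
  in \<open>\<Phi>\<close> is shadowed.  This amounts to typing terms up to renaming of locally defined
  procedures.  If \<open>f \<notin> dom \<Phi>\<close> were required here, subject reduction would fail: the term
  \<open>proc f \<dots> {M}; proc f \<dots> {M}\<close> (similarly, a definition inside a loop) would no longer be typable
  after the first definition has been executed and \<open>f\<close> has entered the procedure context.\<close>

inductive typing :: "pctx \<Rightarrow> vctx \<Rightarrow> var tm \<Rightarrow> vctx \<Rightarrow> bool" where
  NewUnit: "\<lbrakk>wf_ctxs \<Phi> \<Gamma>; u \<notin> dom \<Gamma>\<rbrakk>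
    \<Longrightarrow> typing \<Phi> \<Gamma> (NewUnit u) (\<Gamma>(u \<mapsto> One))"
| Discard: "\<lbrakk>wf_ctxs \<Phi> \<Gamma>; x \<notin> dom \<Gamma>; closed_ty A\<rbrakk>
    \<Longrightarrow> typing \<Phi> (\<Gamma>(x \<mapsto> A)) (Discard x) \<Gamma>"
| Copy: "\<lbrakk>wf_ctxs \<Phi> \<Gamma>; x \<notin> dom \<Gamma>; y \<notin> dom (\<Gamma>(x \<mapsto> P)); closed_ty P; classical P\<rbrakk>
    \<Longrightarrow> typing \<Phi> (\<Gamma>(x \<mapsto> P)) (Copy y x) (\<Gamma>(x \<mapsto> P, y \<mapsto> P))"
| Skip: "wf_ctxs \<Phi> \<Gamma> \<Longrightarrow> typing \<Phi> \<Gamma> Skip \<Gamma>"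
| Seq: "\<lbrakk>typing \<Phi> \<Gamma> M \<Gamma>'; typing \<Phi> \<Gamma>' N \<Sigma>\<rbrakk> \<Longrightarrow> typing \<Phi> \<Gamma> (Seq M N) \<Sigma>"
| While: "\<lbrakk>b \<notin> dom \<Gamma>; typing \<Phi> (\<Gamma>(b \<mapsto> bit_ty)) M (\<Gamma>(b \<mapsto> bit_ty))\<rbrakk>
    \<Longrightarrow> typing \<Phi> (\<Gamma>(b \<mapsto> bit_ty)) (While b M) (\<Gamma>(b \<mapsto> bit_ty))"
| NewQbit: "\<lbrakk>wf_ctxs \<Phi> \<Gamma>; q \<notin> dom \<Gamma>\<rbrakk>
    \<Longrightarrow> typing \<Phi> \<Gamma> (NewQbit q) (\<Gamma>(q \<mapsto> Qbit))"
| Measure: "\<lbrakk>wf_ctxs \<Phi> \<Gamma>; q \<notin> dom \<Gamma>; b \<notin> dom \<Gamma>\<rbrakk>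
    \<Longrightarrow> typing \<Phi> (\<Gamma>(q \<mapsto> Qbit)) (Measure b q) (\<Gamma>(b \<mapsto> bit_ty))"
| Gate: "\<lbrakk>wf_ctxs \<Phi> \<Gamma>; distinct qs; \<forall>q \<in> set qs. \<Gamma> q = Some Qbit; unitary_mat (2 ^ length qs) S\<rbrakk>
    \<Longrightarrow> typing \<Phi> \<Gamma> (Gate qs S) \<Gamma>"
| Left: "\<lbrakk>wf_ctxs \<Phi> \<Gamma>; x \<notin> dom \<Gamma>; y \<notin> dom \<Gamma>; closed_ty A; closed_ty B\<rbrakk>
    \<Longrightarrow> typing \<Phi> (\<Gamma>(x \<mapsto> A)) (Left A B y x) (\<Gamma>(y \<mapsto> Sum A B))"
| Right: "\<lbrakk>wf_ctxs \<Phi> \<Gamma>; x \<notin> dom \<Gamma>; y \<notin> dom \<Gamma>; closed_ty A; closed_ty B\<rbrakk>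
    \<Longrightarrow> typing \<Phi> (\<Gamma>(x \<mapsto> B)) (Right A B y x) (\<Gamma>(y \<mapsto> Sum A B))"
| Case: "\<lbrakk>y \<notin> dom \<Gamma>; x1 \<notin> dom \<Gamma>; x2 \<notin> dom \<Gamma>;
      typing \<Phi> (\<Gamma>(x1 \<mapsto> A)) M1 \<Sigma>; typing \<Phi> (\<Gamma>(x2 \<mapsto> B)) M2 \<Sigma>\<rbrakk>
    \<Longrightarrow> typing \<Phi> (\<Gamma>(y \<mapsto> Sum A B)) (Case y x1 M1 x2 M2) \<Sigma>"
| Pair: "\<lbrakk>wf_ctxs \<Phi> \<Gamma>; x1 \<notin> dom \<Gamma>; x2 \<notin> dom (\<Gamma>(x1 \<mapsto> A)); x \<notin> dom \<Gamma>; closed_ty A; closed_ty B\<rbrakk>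
    \<Longrightarrow> typing \<Phi> (\<Gamma>(x1 \<mapsto> A, x2 \<mapsto> B)) (Pair x x1 x2) (\<Gamma>(x \<mapsto> Tensor A B))"
| Unpair: "\<lbrakk>wf_ctxs \<Phi> \<Gamma>; x1 \<notin> dom \<Gamma>; x2 \<notin> dom (\<Gamma>(x1 \<mapsto> A)); x \<notin> dom \<Gamma>; closed_ty A; closed_ty B\<rbrakk>
    \<Longrightarrow> typing \<Phi> (\<Gamma>(x \<mapsto> Tensor A B)) (Unpair x1 x2 x) (\<Gamma>(x1 \<mapsto> A, x2 \<mapsto> B))"
| Fold: "\<lbrakk>wf_ctxs \<Phi> \<Gamma>; x \<notin> dom \<Gamma>; y \<notin> dom \<Gamma>; closed_ty (Mu A)\<rbrakk>
    \<Longrightarrow> typing \<Phi> (\<Gamma>(x \<mapsto> unroll A)) (Fold A y x) (\<Gamma>(y \<mapsto> Mu A))"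
| Unfold: "\<lbrakk>wf_ctxs \<Phi> \<Gamma>; x \<notin> dom \<Gamma>; y \<notin> dom \<Gamma>; closed_ty (Mu A)\<rbrakk>
    \<Longrightarrow> typing \<Phi> (\<Gamma>(x \<mapsto> Mu A)) (Unfold y x) (\<Gamma>(y \<mapsto> unroll A))"
| Proc: "\<lbrakk>wf_ctxs \<Phi> \<Gamma>; typing (\<Phi>(f \<mapsto> (A, B))) [x \<mapsto> A] M [y \<mapsto> B]\<rbrakk>
    \<Longrightarrow> typing \<Phi> \<Gamma> (Proc f x A y B M) \<Gamma>"
| Call: "\<lbrakk>wf_ctxs \<Phi> \<Gamma>; \<Phi> f = Some (A, B); x \<notin> dom \<Gamma>; y \<notin> dom \<Gamma>\<rbrakk>
    \<Longrightarrow> typing \<Phi> (\<Gamma>(x \<mapsto> A)) (Call y f x) (\<Gamma>(y \<mapsto> B))"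

datatype val =
    VUnit
  | VPtr nat
  | VLeft ty ty val
  | VRight ty ty val
  | VPair val val
  | VFold ty val    \<comment> \<open>\<open>VFold A v\<close> is \<open>fold\<^bsub>\<mu>X.A\<^esub> v\<close>\<close>

abbreviation ff :: val where "ff \<equiv> VLeft One One VUnit"
abbreviation tt :: val where "tt \<equiv> VRight One One VUnit"

inductive val_typing :: "nat set \<Rightarrow> val \<Rightarrow> ty \<Rightarrow> bool" where
  VUnit: "val_typing {} VUnit One"
| VPtr: "val_typing {n} (VPtr n) Qbit"
| VLeft: "val_typing Q v A \<Longrightarrow> val_typing Q (VLeft A B v) (Sum A B)"
| VRight: "val_typing Q v B \<Longrightarrow> val_typing Q (VRight A B v) (Sum A B)"
| VPair: "\<lbrakk>val_typing Q1 v A; val_typing Q2 w B; Q1 \<inter> Q2 = {}\<rbrakk>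
    \<Longrightarrow> val_typing (Q1 \<union> Q2) (VPair v w) (Tensor A B)"
| VFold: "val_typing Q v (unroll A) \<Longrightarrow> val_typing Q (VFold A v) (Mu A)"

type_synonym assignment = "var \<rightharpoonup> val"

definition assignment_typing :: "nat set \<Rightarrow> vctx \<Rightarrow> assignment \<Rightarrow> bool" where
  "assignment_typing Q \<Gamma> V \<longleftrightarrow> dom V = dom \<Gamma> \<and>
     (\<exists>R. (\<forall>x \<in> dom V. val_typing (R x) (the (V x)) (the (\<Gamma> x))) \<and>
          disjoint_family_on R (dom V) \<and> Q = (\<Union>x \<in> dom V. R x))"

datatype procdef = ProcDef (def_name: pname) var ty var ty "var tm"

type_synonym store = "procdef set"

text \<open>An extension \<open>\<Omega>, f :: \<dots>\<close> of a store presupposes that \<open>\<Omega>\<close> does not define \<open>f\<close>.\<close>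

inductive store_typing :: "pctx \<Rightarrow> store \<Rightarrow> bool" where
  empty: "store_typing Map.empty {}"
| extend: "\<lbrakk>store_typing \<Phi> \<Omega>; f \<notin> def_name ` \<Omega>; typing (\<Phi>(f \<mapsto> (A, B))) [x \<mapsto> A] M [y \<mapsto> B]\<rbrakk>
    \<Longrightarrow> store_typing (\<Phi>(f \<mapsto> (A, B))) (insert (ProcDef f x A y B M) \<Omega>)"

type_synonym config = "var tm \<times> assignment \<times> store \<times> complex mat"

text \<open>The conjunct \<open>qstate \<rho>\<close> is the requirement on the matrix component of a configuration.\<close>

fun config_typing :: "pctx \<Rightarrow> vctx \<Rightarrow> vctx \<Rightarrow> nat set \<Rightarrow> config \<Rightarrow> bool" where
  "config_typing \<Phi> \<Gamma> \<Sigma> Q (M, V, \<Omega>, \<rho>) \<longleftrightarrow>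
     qstate \<rho> \<and> typing \<Phi> \<Gamma> M \<Sigma> \<and> assignment_typing Q \<Gamma> V \<and> store_typing \<Phi> \<Omega> \<and> Q = {1..qdim \<rho>}"

text \<open>\<open>reindex Qv\<close> is \<open>r'\<^sub>v\<close> and \<open>reindex_all Qv\<close> is \<open>r\<^sub>v\<close> for a value \<open>v\<close> with pointers \<open>Qv\<close>.\<close>

primrec reindex :: "nat set \<Rightarrow> val \<Rightarrow> val" where
  "reindex Q VUnit = VUnit"
| "reindex Q (VPtr k) = VPtr (k - card {i \<in> Q. i < k})"
| "reindex Q (VLeft A B v) = VLeft A B (reindex Q v)"
| "reindex Q (VRight A B v) = VRight A B (reindex Q v)"
| "reindex Q (VPair v w) = VPair (reindex Q v) (reindex Q w)"
| "reindex Q (VFold A v) = VFold A (reindex Q v)"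

definition reindex_all :: "nat set \<Rightarrow> assignment \<Rightarrow> assignment" where
  "reindex_all Q V = map_option (reindex Q) \<circ> V"

definition if_then :: "var \<Rightarrow> var \<Rightarrow> var tm \<Rightarrow> var tm" where
  "if_then u b N = Case b u (Left One One b u) u (Seq (Right One One b u) N)"

text \<open>The side conditions \<open>x \<notin> dom V\<close> are those presupposed by the notation \<open>V, x = v\<close>.

  In \<open>call\<close>, the renaming has to be injective on the variables of the procedure: identifying
  two of them can make the body untypable.  Hence a call with equal argument and result variables
  reduces only if the parameter and result variables of the definition are equal too, and conversely.\<close>

inductive reduces :: "config \<Rightarrow> config \<Rightarrow> bool" (infix "\<leadsto>" 50) where
  unit: "u \<notin> dom V \<Longrightarrow> (NewUnit u, V, \<Omega>, \<rho>) \<leadsto> (Skip, V(u \<mapsto> VUnit), \<Omega>, \<rho>)"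
| discard: "\<lbrakk>x \<notin> dom V; val_typing Qv v A\<rbrakk>
    \<Longrightarrow> (Discard x, V(x \<mapsto> v), \<Omega>, \<rho>) \<leadsto> (Skip, reindex_all Qv V, \<Omega>, ptrace Qv \<rho>)"
| copy: "\<lbrakk>x \<notin> dom V; y \<notin> dom (V(x \<mapsto> v))\<rbrakk>
    \<Longrightarrow> (Copy y x, V(x \<mapsto> v), \<Omega>, \<rho>) \<leadsto> (Skip, V(x \<mapsto> v, y \<mapsto> v), \<Omega>, \<rho>)"
| qbit: "q \<notin> dom V
    \<Longrightarrow> (NewQbit q, V, \<Omega>, \<rho>) \<leadsto> (Skip, V(q \<mapsto> VPtr (qdim \<rho> + 1)), \<Omega>, add_qubit \<rho>)"
| gate: "\<lbrakk>distinct qs; list_all2 (\<lambda>q m. V q = Some (VPtr m)) qs ms\<rbrakk>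
    \<Longrightarrow> (Gate qs S, V, \<Omega>, \<rho>) \<leadsto> (Skip, V, \<Omega>, apply_gate ms S \<rho>)"
| measure0: "\<lbrakk>q \<notin> dom V; b \<notin> dom V\<rbrakk>
    \<Longrightarrow> (Measure b q, V(q \<mapsto> VPtr m), \<Omega>, \<rho>) \<leadsto> (Skip, (reindex_all {m} V)(b \<mapsto> ff), \<Omega>, project m 0 \<rho>)"
| measure1: "\<lbrakk>q \<notin> dom V; b \<notin> dom V\<rbrakk>
    \<Longrightarrow> (Measure b q, V(q \<mapsto> VPtr m), \<Omega>, \<rho>) \<leadsto> (Skip, (reindex_all {m} V)(b \<mapsto> tt), \<Omega>, project m 1 \<rho>)"
| seq1: "(Seq Skip N, V, \<Omega>, \<rho>) \<leadsto> (N, V, \<Omega>, \<rho>)"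
| seq2: "(M, V, \<Omega>, \<rho>) \<leadsto> (M', V', \<Omega>', \<rho>') \<Longrightarrow> (Seq M N, V, \<Omega>, \<rho>) \<leadsto> (Seq M' N, V', \<Omega>', \<rho>')"
| while: "\<lbrakk>b \<in> dom V; u \<notin> dom V\<rbrakk>
    \<Longrightarrow> (While b M, V, \<Omega>, \<rho>) \<leadsto> (if_then u b (Seq M (While b M)), V, \<Omega>, \<rho>)"
| left: "\<lbrakk>x \<notin> dom V; y \<notin> dom V\<rbrakk>
    \<Longrightarrow> (Left A B y x, V(x \<mapsto> v), \<Omega>, \<rho>) \<leadsto> (Skip, V(y \<mapsto> VLeft A B v), \<Omega>, \<rho>)"
| right: "\<lbrakk>x \<notin> dom V; y \<notin> dom V\<rbrakk>
    \<Longrightarrow> (Right A B y x, V(x \<mapsto> v), \<Omega>, \<rho>) \<leadsto> (Skip, V(y \<mapsto> VRight A B v), \<Omega>, \<rho>)"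
| case_left: "\<lbrakk>y \<notin> dom V; x1 \<notin> dom V\<rbrakk>
    \<Longrightarrow> (Case y x1 M1 x2 M2, V(y \<mapsto> VLeft A B v), \<Omega>, \<rho>) \<leadsto> (M1, V(x1 \<mapsto> v), \<Omega>, \<rho>)"
| case_right: "\<lbrakk>y \<notin> dom V; x2 \<notin> dom V\<rbrakk>
    \<Longrightarrow> (Case y x1 M1 x2 M2, V(y \<mapsto> VRight A B v), \<Omega>, \<rho>) \<leadsto> (M2, V(x2 \<mapsto> v), \<Omega>, \<rho>)"
| pair: "\<lbrakk>x1 \<notin> dom V; x2 \<notin> dom (V(x1 \<mapsto> v1)); x \<notin> dom V\<rbrakk>
    \<Longrightarrow> (Pair x x1 x2, V(x1 \<mapsto> v1, x2 \<mapsto> v2), \<Omega>, \<rho>) \<leadsto> (Skip, V(x \<mapsto> VPair v1 v2), \<Omega>, \<rho>)"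
| unpair: "\<lbrakk>x \<notin> dom V; x1 \<notin> dom V; x2 \<notin> dom (V(x1 \<mapsto> v1))\<rbrakk>
    \<Longrightarrow> (Unpair x1 x2 x, V(x \<mapsto> VPair v1 v2), \<Omega>, \<rho>) \<leadsto> (Skip, V(x1 \<mapsto> v1, x2 \<mapsto> v2), \<Omega>, \<rho>)"
| fold: "\<lbrakk>x \<notin> dom V; y \<notin> dom V\<rbrakk>
    \<Longrightarrow> (Fold A y x, V(x \<mapsto> v), \<Omega>, \<rho>) \<leadsto> (Skip, V(y \<mapsto> VFold A v), \<Omega>, \<rho>)"
| unfold: "\<lbrakk>x \<notin> dom V; y \<notin> dom V\<rbrakk>
    \<Longrightarrow> (Unfold y x, V(x \<mapsto> VFold A v), \<Omega>, \<rho>) \<leadsto> (Skip, V(y \<mapsto> v), \<Omega>, \<rho>)"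
| procedure: "f \<notin> def_name ` \<Omega>
    \<Longrightarrow> (Proc f x A y B M, V, \<Omega>, \<rho>) \<leadsto> (Skip, V, insert (ProcDef f x A y B M) \<Omega>, \<rho>)"
| call: "\<lbrakk>x1 \<in> dom V; ProcDef f x2 A y2 B M \<in> \<Omega>;
      \<sigma> x2 = x1; \<sigma> y2 = y1; inj_on \<sigma> (vars M \<union> {x2, y2});
      \<forall>z \<in> vars M - {x2, y2}. \<sigma> z \<notin> dom V \<union> {x1, y1}\<rbrakk>
    \<Longrightarrow> (Call y1 f x1, V, \<Omega>, \<rho>) \<leadsto> (rename \<sigma> M, V, \<Omega>, \<rho>)"

end

theory Submission
  imports Defs
begin

text \<open>Preservation is proved by induction on the reduction, strengthened so that the new procedure
  context extends the old one; weakening then retypes the continuation of a sequence.  A call needs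
  a combined renaming and frame property: the body, typed in a context with the parameter alone,
  stays typed after an injective renaming and under any extension by variables not in the image.
  Discarding and measuring renumber the remaining pointers, and the renumbering is the
  order isomorphism of \<open>{1..N} - P\<close> onto \<open>{1..N - card P}\<close>.  On states, a new qubit and
  a projection are congruences \<open>K\<^sup>\<dagger> \<rho> K\<close>, so they keep positive semidefiniteness; the traces
  of the two projections at a qubit add up to the trace of \<open>\<rho>\<close>, and a gate acts as an isometry.
  Uniqueness holds because values carry enough annotations to determine their types and
  pointers, and a store determines its procedure context.\<close>

section \<open>Quantum states\<close>

lemma mat_adjoint_carrier [simp]: "A \<in> carrier_mat n m \<Longrightarrow> mat_adjoint A \<in> carrier_mat m n"
  unfolding mat_adjoint_def carrier_mat_def by (auto simp: mat_of_rows_def)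

lemma dim_mat_adjoint [simp]:
  "dim_row (mat_adjoint A) = dim_col A" "dim_col (mat_adjoint A) = dim_row A"
  unfolding mat_adjoint_def by (auto simp: mat_of_rows_def)

lemma index_mat_adjoint [simp]:
  assumes "i < dim_col A" "j < dim_row A"
  shows "mat_adjoint A $$ (i, j) = conjugate (A $$ (j, i))"
  using assms unfolding mat_adjoint_def by (simp add: mat_of_rows_def)

lemma mat_adjoint_adjoint [simp]:
  fixes A :: "complex mat"
  shows "mat_adjoint (mat_adjoint A) = A"
  by (rule eq_matI) auto

text \<open>Since \<open>\<bullet>c\<close> conjugates its second argument, both sides expand to the
  same double sum with the summations swapped.\<close>

lemma cscalar_prod_mat_adjoint:
  fixes K :: "complex mat"
  assumes K: "K \<in> carrier_mat n m" and w: "w \<in> carrier_vec n" and v: "v \<in> carrier_vec m"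
  shows "(mat_adjoint K *\<^sub>v w) \<bullet>c v = w \<bullet>c (K *\<^sub>v v)"
proof -
  have "(mat_adjoint K *\<^sub>v w) \<bullet>c v
      = (\<Sum>i<m. (\<Sum>j<n. cnj (K $$ (j, i)) * w $ j) * cnj (v $ i))"
    using assms by (auto simp: scalar_prod_def lessThan_atLeast0 intro!: sum.cong)
  also have "\<dots> = (\<Sum>i<m. \<Sum>j<n. w $ j * (cnj (K $$ (j, i)) * cnj (v $ i)))"
    by (simp add: sum_distrib_left sum_distrib_right mult_ac)
  also have "\<dots> = (\<Sum>j<n. \<Sum>i<m. w $ j * (cnj (K $$ (j, i)) * cnj (v $ i)))"
    by (rule sum.swap)
  also have "\<dots> = w \<bullet>c (K *\<^sub>v v)"
    using assms by (auto simp: scalar_prod_def lessThan_atLeast0 sum_distrib_left intro!: sum.cong)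
  finally show ?thesis .
qed

text \<open>The quadratic form of the congruence at \<open>v\<close> is that of \<rho> at
  \<open>K v\<close>. As \<open>K\<close> may be rectangular, adding a qubit, projecting and
  applying a gate are all instances.\<close>

lemma psd_congruence:
  assumes \<rho>: "\<rho> \<in> carrier_mat n n" "psd \<rho>" and K: "K \<in> carrier_mat n m"
  shows "psd (mat_adjoint K * \<rho> * K)"
proof -
  have "0 \<le> ((mat_adjoint K * \<rho> * K) *\<^sub>v v) \<bullet>c v" if v: "v \<in> carrier_vec m" for v
  proof -
    have Kv: "K *\<^sub>v v \<in> carrier_vec n" using K v by simp
    have "mat_adjoint K * \<rho> \<in> carrier_mat m n" using K \<rho>(1) by auto
    then have "(mat_adjoint K * \<rho> * K) *\<^sub>v v = mat_adjoint K *\<^sub>v (\<rho> *\<^sub>v (K *\<^sub>v v))"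
      using assoc_mult_mat_vec[OF _ K v] assoc_mult_mat_vec[OF mat_adjoint_carrier[OF K] \<rho>(1) Kv]
      by simp
    then have "((mat_adjoint K * \<rho> * K) *\<^sub>v v) \<bullet>c v = (\<rho> *\<^sub>v (K *\<^sub>v v)) \<bullet>c (K *\<^sub>v v)"
      using cscalar_prod_mat_adjoint[OF K _ v] \<rho>(1) Kv by simp
    then show ?thesis using \<rho> Kv by (simp add: psd_def)
  qed
  then show ?thesis using K \<rho> by (auto simp: psd_def)
qed

lemma psd_add:
  assumes "A \<in> carrier_mat n n" "B \<in> carrier_mat n n" "psd A" "psd B"
  shows "psd (A + B)"
proof -
  have "0 \<le> ((A + B) *\<^sub>v v) \<bullet>c v" if v: "v \<in> carrier_vec n" for v
  proof -
    have "((A + B) *\<^sub>v v) \<bullet>c v = (A *\<^sub>v v) \<bullet>c v + (B *\<^sub>v v) \<bullet>c v"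
      using assms v
      by (simp add: add_mult_distrib_mat_vec[of _ n n] add_scalar_prod_distrib[of _ n])
    then show ?thesis using assms v by (simp add: psd_def)
  qed
  then show ?thesis using assms by (auto simp: psd_def)
qed

text \<open>Diagonal entries are values of the quadratic form at unit vectors.\<close>

lemma mat_trace_psd_nonneg:
  assumes "psd A"
  shows "0 \<le> mat_trace A"
  unfolding mat_trace_def
proof (rule sum_nonneg)
  fix i assume "i \<in> {..<dim_row A}"
  define n where "n = dim_row A"
  have i: "i < n" and A: "A \<in> carrier_mat n n"
    using \<open>i \<in> _\<close> assms by (auto simp: psd_def n_def)
  have u: "conjugate (unit_vec n i) = (unit_vec n i :: complex vec)"
    by (rule eq_vecI) (auto simp: unit_vec_def)
  have "(A *\<^sub>v unit_vec n i) \<bullet>c unit_vec n i = A $$ (i, i)"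
    unfolding u using A i by (simp add: scalar_prod_right_unit)
  moreover have "0 \<le> (A *\<^sub>v unit_vec n i) \<bullet>c unit_vec n i"
    using assms by (simp add: psd_def n_def)
  ultimately show "0 \<le> A $$ (i, i)" by simp
qed

lemma mat_trace_mult_commute:
  assumes "A \<in> carrier_mat n m" "B \<in> carrier_mat m n"
  shows "mat_trace (A * B) = mat_trace (B * A)"
proof -
  have "mat_trace (A * B) = (\<Sum>i<n. \<Sum>j<m. A $$ (i, j) * B $$ (j, i))"
    using assms by (auto simp: mat_trace_def scalar_prod_def lessThan_atLeast0 intro!: sum.cong)
  also have "\<dots> = (\<Sum>j<m. \<Sum>i<n. B $$ (j, i) * A $$ (i, j))"
    by (subst sum.swap) (simp add: mult.commute)
  also have "\<dots> = mat_trace (B * A)"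
    using assms by (auto simp: mat_trace_def scalar_prod_def lessThan_atLeast0 intro!: sum.cong)
  finally show ?thesis .
qed

lemma mat_trace_add:
  assumes "A \<in> carrier_mat n n" "B \<in> carrier_mat n n"
  shows "mat_trace (A + B) = mat_trace A + mat_trace B"
  using assms by (simp add: mat_trace_def sum.distrib)

lemma index_congruence:
  fixes \<rho> :: "complex mat"
  assumes "\<rho> \<in> carrier_mat n n" "K \<in> carrier_mat n m" "a < m" "b < m"
  shows "(mat_adjoint K * \<rho> * K) $$ (a, b)
    = (\<Sum>s<n. \<Sum>r<n. cnj (K $$ (r, a)) * \<rho> $$ (r, s) * K $$ (s, b))"
  using assms
  by (auto simp: scalar_prod_def lessThan_atLeast0 sum_distrib_right sum_distrib_left mult_ac intro!: sum.cong)

text \<open>Each column of \<open>K\<close> is the unit vector at \<open>e c\<close>, so the double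
  sum collapses to one term and the congruence cuts out the submatrix of \<rho> indexed by
  \<open>e\<close>.\<close>

lemma index_congruence_selection:
  fixes \<rho> K :: "complex mat"
  assumes \<rho>: "\<rho> \<in> carrier_mat n n" and K: "K \<in> carrier_mat n m"
    and sel: "\<And>r c. r < n \<Longrightarrow> c < m \<Longrightarrow> K $$ (r, c) = of_bool (r = e c)"
    and e: "\<And>c. c < m \<Longrightarrow> e c < n" and ab: "a < m" "b < m"
  shows "(mat_adjoint K * \<rho> * K) $$ (a, b) = \<rho> $$ (e a, e b)"
proof -
  have "(mat_adjoint K * \<rho> * K) $$ (a, b)
      = (\<Sum>s<n. \<Sum>r<n. if r = e a then (if s = e b then \<rho> $$ (r, s) else 0) else 0)"
    unfolding index_congruence[OF \<rho> K ab] using sel ab by (intro sum.cong) auto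
  also have "\<dots> = \<rho> $$ (e a, e b)"
    using e ab by (simp add: sum.delta)
  finally show ?thesis .
qed

section \<open>Dimension and characterisation of states\<close>

lemma qdim_carrier: "\<rho> \<in> carrier_mat (2 ^ n) (2 ^ n) \<Longrightarrow> qdim \<rho> = n"
  unfolding qdim_def by (rule the_equality) auto

lemma qstate_iff:
  "qstate \<rho> \<longleftrightarrow> \<rho> \<in> carrier_mat (2 ^ qdim \<rho>) (2 ^ qdim \<rho>) \<and> psd \<rho> \<and> mat_trace \<rho> \<le> 1"
proof
  assume "qstate \<rho>"
  then obtain n where n: "\<rho> \<in> carrier_mat (2 ^ n) (2 ^ n)" and "psd \<rho>" "mat_trace \<rho> \<le> 1"
    by (auto simp: qstate_def)
  with qdim_carrier[OF n] n
  show "\<rho> \<in> carrier_mat (2 ^ qdim \<rho>) (2 ^ qdim \<rho>) \<and> psd \<rho> \<and> mat_trace \<rho> \<le> 1"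
    by simp
next
  assume "\<rho> \<in> carrier_mat (2 ^ qdim \<rho>) (2 ^ qdim \<rho>) \<and> psd \<rho> \<and> mat_trace \<rho> \<le> 1"
  then show "qstate \<rho>" unfolding qstate_def using mat_trace_psd_nonneg by blast
qed

lemma qstateI:
  "\<lbrakk>\<rho> \<in> carrier_mat (2 ^ n) (2 ^ n); psd \<rho>; mat_trace \<rho> \<le> 1\<rbrakk> \<Longrightarrow> qstate \<rho>"
  unfolding qstate_def using mat_trace_psd_nonneg by blast

section \<open>Adding a fresh qubit\<close>

text \<open>The fresh qubit is the rightmost tensor factor, hence the lowest binary digit of an
  index; being in state 0, it leaves nonzero entries only at even indices.\<close>

lemma add_qubit_eq:
  assumes \<rho>: "\<rho> \<in> carrier_mat n n"
  shows "add_qubit \<rho> = mat (2 * n) (2 * n)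
    (\<lambda>(i, j). if even i \<and> even j then \<rho> $$ (i div 2, j div 2) else 0)"
proof (rule eq_matI)
  fix i j
  assume "i < dim_row (mat (2 * n) (2 * n)
      (\<lambda>(i, j). if even i \<and> even j then \<rho> $$ (i div 2, j div 2) else 0))"
    and "j < dim_col (mat (2 * n) (2 * n)
      (\<lambda>(i, j). if even i \<and> even j then \<rho> $$ (i div 2, j div 2) else 0))"
  then have ij: "i < 2 * n" "j < 2 * n" by auto
  have k: "(ket 0 * mat_adjoint (ket 0)) $$ (a, b) = of_bool (a = 0 \<and> b = 0)"
    if "a < 2" "b < 2" for a b
    using that by (auto simp: ket_def scalar_prod_def)
  show "add_qubit \<rho> $$ (i, j) = mat (2 * n) (2 * n)
      (\<lambda>(i, j). if even i \<and> even j then \<rho> $$ (i div 2, j div 2) else 0) $$ (i, j)"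
    using \<rho> ij k by (auto simp: add_qubit_def kron_def ket_def[of 0] mult.commute even_iff_mod_2_eq_zero)
qed (use \<rho> in \<open>auto simp: add_qubit_def kron_def ket_def\<close>)

lemma sum_even:
  fixes f :: "nat \<Rightarrow> 'a :: comm_monoid_add"
  shows "(\<Sum>i<2 * n. if even i then f (i div 2) else 0) = (\<Sum>i<n. f i)"
proof (induction n)
  case (Suc n)
  have "2 * Suc n = Suc (Suc (2 * n))" by simp
  then show ?case using Suc by (simp add: add.commute)
qed simp

lemma psd_add_qubit:
  assumes \<rho>: "\<rho> \<in> carrier_mat n n" "psd \<rho>"
  shows "psd (add_qubit \<rho>)"
proof -
  \<comment> \<open>\<open>K\<close> is the identity tensored with the bra of 0, so that the
    congruence tensors \<rho> with the projector onto 0.\<close>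
  define K :: "complex mat" where "K = mat n (2 * n) (\<lambda>(j, i). of_bool (i = 2 * j))"
  have K: "K \<in> carrier_mat n (2 * n)" by (simp add: K_def)
  \<comment> \<open>Solved for the row index, the entry has the shape that collapses the sums over
    \<open>r\<close> and \<open>s\<close>.\<close>
  have K_eq: "K $$ (r, a) = (if r = a div 2 then of_bool (even a) else 0)"
    if "r < n" "a < 2 * n" for r a
  proof -
    have "a = 2 * r \<longleftrightarrow> r = a div 2 \<and> even a" by presburger
    then show ?thesis using that by (simp add: K_def)
  qed
  have "add_qubit \<rho> = mat_adjoint K * \<rho> * K"
  proof (rule eq_matI)
    fix a b assume "a < dim_row (mat_adjoint K * \<rho> * K)" "b < dim_col (mat_adjoint K * \<rho> * K)"
    then have ab: "a < 2 * n" "b < 2 * n" using K by auto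
    have "(mat_adjoint K * \<rho> * K) $$ (a, b)
      = (\<Sum>s<n. \<Sum>r<n. cnj (K $$ (r, a)) * \<rho> $$ (r, s) * K $$ (s, b))"
      using index_congruence[OF \<rho>(1) K ab] .
    also have "\<dots> = (\<Sum>s<n. \<Sum>r<n. if r = a div 2 then
        (if s = b div 2 then (if even a \<and> even b then \<rho> $$ (r, s) else 0) else 0) else 0)"
      using ab by (intro sum.cong) (auto simp: K_eq)
    also have "\<dots> = (if even a \<and> even b then \<rho> $$ (a div 2, b div 2) else 0)"
      using ab by (simp add: sum.delta less_mult_imp_div_less mult.commute)
    finally show "add_qubit \<rho> $$ (a, b) = (mat_adjoint K * \<rho> * K) $$ (a, b)"
      using ab by (simp add: add_qubit_eq[OF \<rho>(1)])
  qed (use K in \<open>auto simp: add_qubit_eq[OF \<rho>(1)]\<close>)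
  then show ?thesis using psd_congruence[OF \<rho> K] by simp
qed

lemma mat_trace_add_qubit:
  assumes \<rho>: "\<rho> \<in> carrier_mat n n"
  shows "mat_trace (add_qubit \<rho>) = mat_trace \<rho>"
proof -
  have "mat_trace (add_qubit \<rho>) = (\<Sum>i<2 * n. if even i then \<rho> $$ (i div 2, i div 2) else 0)"
    by (auto simp: add_qubit_eq[OF \<rho>] mat_trace_def intro!: sum.cong)
  also have "\<dots> = mat_trace \<rho>"
    using \<rho> by (simp add: sum_even[of "\<lambda>i. \<rho> $$ (i, i)"] mat_trace_def)
  finally show ?thesis .
qed

lemma qstate_add_qubit:
  assumes "qstate \<rho>"
  shows "qstate (add_qubit \<rho>)" "qdim (add_qubit \<rho>) = Suc (qdim \<rho>)"
proof -
  have \<rho>: "\<rho> \<in> carrier_mat (2 ^ qdim \<rho>) (2 ^ qdim \<rho>)" "psd \<rho>" "mat_trace \<rho> \<le> 1"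
    using assms by (auto simp: qstate_iff)
  have c: "add_qubit \<rho> \<in> carrier_mat (2 ^ Suc (qdim \<rho>)) (2 ^ Suc (qdim \<rho>))"
    using add_qubit_eq[OF \<rho>(1)] by simp
  then show "qdim (add_qubit \<rho>) = Suc (qdim \<rho>)" by (rule qdim_carrier)
  show "qstate (add_qubit \<rho>)"
    using c psd_add_qubit[OF \<rho>(1,2)] \<rho>(3) by (intro qstateI[OF c]) (simp_all add: mat_trace_add_qubit[OF \<rho>(1)])
qed

section \<open>Projections, measurement and partial traces\<close>

text \<open>The basis vector obtained from the one with index \<open>c\<close> by inserting a qubit of value \<open>i\<close> and
  weight \<open>p\<close>.\<close>

definition insert_digit :: "nat \<Rightarrow> nat \<Rightarrow> nat \<Rightarrow> nat" where
  "insert_digit p i c = c div p * (2 * p) + i * p + c mod p"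

lemma insert_digit_less:
  assumes "p > 0" "i < 2" "c < M * p"
  shows "insert_digit p i c < 2 * (M * p)"
proof -
  have "c div p < M" using assms by (simp add: less_mult_imp_div_less)
  then have "Suc (c div p) * (2 * p) \<le> M * (2 * p)" by (intro mult_right_mono) auto
  then have "c div p * (2 * p) + 2 * p \<le> 2 * (M * p)" by (simp add: algebra_simps)
  moreover have "c mod p < p" "i * p \<le> 1 * p" using assms by (simp_all del: mult_le_cancel2)
  ultimately show ?thesis unfolding insert_digit_def by linarith
qed

lemma digits_insert_digit:
  assumes "p > 0" "i < 2"
  shows "insert_digit p i c div p = 2 * (c div p) + i" "insert_digit p i c mod p = c mod p"
proof -
  have "insert_digit p i c = c mod p + (2 * (c div p) + i) * p"
    by (simp add: insert_digit_def algebra_simps)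
  then show "insert_digit p i c div p = 2 * (c div p) + i" "insert_digit p i c mod p = c mod p"
    using assms(1) by simp_all
qed

text \<open>A number is determined by its digits above, at and below the weight \<open>p\<close>;
  these are the three components on the right.\<close>

lemma eq_insert_digit_iff:
  assumes "p > 0" "i < 2"
  shows "r = insert_digit p i c \<longleftrightarrow> r div p div 2 = c div p \<and> r div p mod 2 = i \<and> r mod p = c mod p"
proof
  assume "r div p div 2 = c div p \<and> r div p mod 2 = i \<and> r mod p = c mod p"
  then have "r = (2 * (c div p) + i) * p + c mod p"
    by (metis div_mult_mod_eq mult.commute)
  then show "r = insert_digit p i c" by (simp add: insert_digit_def algebra_simps)
qed (use assms digits_insert_digit[of p i c] in auto)

text \<open>Splits the basis indices by the value of the qubit of weight \<open>p\<close>; this is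
  what separates a trace into the contributions of the two outcomes.\<close>

lemma sum_insert_digit:
  fixes f :: "nat \<Rightarrow> 'a :: comm_monoid_add"
  assumes p: "p > 0"
  shows "(\<Sum>r<2 * (M * p). f r)
    = (\<Sum>c<M * p. f (insert_digit p 0 c)) + (\<Sum>c<M * p. f (insert_digit p 1 c))"
proof -
  have "(\<Sum>r<2 * (M * p). f r) = (\<Sum>(i, c) \<in> {..<2} \<times> {..<M * p}. f (insert_digit p i c))"
  \<comment> \<open>The map \<open>j\<close> extracts the digit of weight \<open>p\<close> and
    closes the gap; \<open>i\<close> inserts it again.\<close>
  proof (rule sum.reindex_bij_witness[where
        j = "\<lambda>r. (r div p mod 2, r div p div 2 * p + r mod p)" and i = "\<lambda>(i, c). insert_digit p i c"])
    fix r assume r: "r \<in> {..<2 * (M * p)}"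
    show inv: "(\<lambda>(i, c). insert_digit p i c) (r div p mod 2, r div p div 2 * p + r mod p) = r"
      unfolding prod.case using p by (intro sym[of r]) (subst eq_insert_digit_iff, auto)
    have "r div p < 2 * M" using r by (simp add: less_mult_imp_div_less mult.assoc)
    then have "Suc (r div p div 2) * p \<le> M * p" by (intro mult_right_mono) auto
    moreover have "r mod p < p" using p by simp
    ultimately show "(r div p mod 2, r div p div 2 * p + r mod p) \<in> {..<2} \<times> {..<M * p}"
      by simp
    show "(case (r div p mod 2, r div p div 2 * p + r mod p) of (i, c) \<Rightarrow> f (insert_digit p i c)) = f r"
      using inv by simp
  next
    fix b :: "nat \<times> nat" assume b: "b \<in> {..<2} \<times> {..<M * p}"
    obtain i c where [simp]: "b = (i, c)" by (cases b)
    show "(\<lambda>r. (r div p mod 2, r div p div 2 * p + r mod p)) ((\<lambda>(i, c). insert_digit p i c) b) = b"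
      using b p by (simp add: digits_insert_digit)
    show "(\<lambda>(i, c). insert_digit p i c) b \<in> {..<2 * (M * p)}"
      using b p insert_digit_less by simp
  qed
  also have "\<dots> = (\<Sum>i<2. \<Sum>c<M * p. f (insert_digit p i c))"
    by (simp add: sum.cartesian_product)
  finally show ?thesis by (simp add: numeral_2_eq_2)
qed

lemma ket_at_carrier:
  assumes "1 \<le> m" "m \<le> N"
  shows "ket_at N m i \<in> carrier_mat (2 ^ N) (2 ^ (N - 1))"
proof -
  have "(2 :: nat) ^ (m - 1) * 2 ^ (N - m) = 2 ^ (N - 1)" using assms by (simp flip: power_add)
  moreover have "(2 :: nat) ^ (m - 1) * 2 * 2 ^ (N - m) = 2 ^ N"
    using assms by (simp flip: power_add power_Suc2)
  ultimately show ?thesis by (auto simp: ket_at_def kron_def ket_def)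
qed

text \<open>The two identity factors compare the digits above and below the qubit, and the ket tests
  the digit itself. Hence \<open>ket_at\<close> is a selection matrix of the kind that
  \<open>index_congruence_selection\<close> handles.\<close>

lemma index_ket_at:
  assumes "1 \<le> m" "m \<le> N" "i < 2" "r < 2 ^ N" "c < 2 ^ (N - 1)"
  shows "ket_at N m i $$ (r, c) = of_bool (r = insert_digit (2 ^ (N - m)) i c)"
proof -
  let ?p = "2 ^ (N - m) :: nat"
  have 1: "2 ^ (m - 1) * ?p = 2 ^ (N - 1)" using assms by (simp flip: power_add)
  have 2: "2 ^ (m - 1) * 2 * ?p = 2 ^ N"
    using assms by (simp flip: power_add power_Suc2)
  have r: "r div ?p < 2 ^ (m - 1) * 2" using assms 2 by (simp add: less_mult_imp_div_less)
  have c: "c div ?p < 2 ^ (m - 1)" using assms 1 by (simp add: less_mult_imp_div_less)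
  have r': "r div ?p div 2 < 2 ^ (m - 1)" using r by (simp add: less_mult_imp_div_less)
  have "r < 2 ^ (m - 1) * 2 * ?p" "c < 2 ^ (m - 1) * ?p" using assms 1 2 by auto
  then have "ket_at N m i $$ (r, c) =
     of_bool (r div ?p div 2 = c div ?p) * of_bool (r div ?p mod 2 = i) * of_bool (r mod ?p = c mod ?p)"
    using r c r' by (auto simp: ket_at_def kron_def ket_def)
  then show ?thesis
    using assms(3) by (auto simp: eq_insert_digit_iff)
qed

lemma project_carrier:
  assumes "\<rho> \<in> carrier_mat (2 ^ N) (2 ^ N)" "1 \<le> m" "m \<le> N"
  shows "project m i \<rho> \<in> carrier_mat (2 ^ (N - 1)) (2 ^ (N - 1))"
  using assms ket_at_carrier[of m N i] by (auto simp: project_def qdim_carrier[OF assms(1)])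

lemma psd_project:
  assumes "\<rho> \<in> carrier_mat (2 ^ N) (2 ^ N)" "1 \<le> m" "m \<le> N" "psd \<rho>"
  shows "psd (project m i \<rho>)"
  using psd_congruence[OF assms(1,4) ket_at_carrier[OF assms(2,3), of i]] assms(1)
  by (simp add: project_def qdim_carrier[OF assms(1)])

text \<open>The diagonals of the two projections partition the diagonal of \<rho>: the probabilities
  of the outcomes add up.\<close>

lemma mat_trace_project:
  assumes \<rho>: "\<rho> \<in> carrier_mat (2 ^ N) (2 ^ N)" and m: "1 \<le> m" "m \<le> N"
  shows "mat_trace (project m 0 \<rho>) + mat_trace (project m 1 \<rho>) = mat_trace \<rho>"
proof -
  let ?p = "2 ^ (N - m) :: nat" and ?M = "2 ^ (m - 1) :: nat"
  have 1: "?M * ?p = 2 ^ (N - 1)" using m by (simp flip: power_add)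
  then have 2: "2 * (?M * ?p) = 2 ^ N" using m by (simp flip: power_Suc)
  have tr: "mat_trace (project m i \<rho>)
      = (\<Sum>c<2 ^ (N - 1). \<rho> $$ (insert_digit ?p i c, insert_digit ?p i c))" if i: "i < 2" for i
  proof -
    have "project m i \<rho> $$ (c, c) = \<rho> $$ (insert_digit ?p i c, insert_digit ?p i c)"
      if "c < 2 ^ (N - 1)" for c
      unfolding project_def qdim_carrier[OF \<rho>]
      using index_ket_at[OF m i] insert_digit_less[OF _ i, of ?p _ ?M] that 1 2
      by (intro index_congruence_selection[OF \<rho> ket_at_carrier[OF m]]) auto
    then show ?thesis
      using project_carrier[OF \<rho> m, of i] by (simp add: mat_trace_def)
  qed
  have "mat_trace \<rho> = (\<Sum>r<2 * (?M * ?p). \<rho> $$ (r, r))"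
    using \<rho> by (simp only: 2) (simp add: mat_trace_def)
  also have "\<dots> = (\<Sum>c<2 ^ (N - 1). \<rho> $$ (insert_digit ?p 0 c, insert_digit ?p 0 c))
      + (\<Sum>c<2 ^ (N - 1). \<rho> $$ (insert_digit ?p 1 c, insert_digit ?p 1 c))"
    using sum_insert_digit[of ?p "\<lambda>r. \<rho> $$ (r, r)" ?M] unfolding 1 by simp
  finally show ?thesis using tr[of 0] tr[of 1] by simp
qed

lemma qstate_project:
  assumes \<rho>: "qstate \<rho>" and m: "m \<in> {1..qdim \<rho>}" and i: "i < 2"
  shows "qstate (project m i \<rho>)" "qdim (project m i \<rho>) = qdim \<rho> - 1"
proof -
  have \<rho>: "\<rho> \<in> carrier_mat (2 ^ qdim \<rho>) (2 ^ qdim \<rho>)" "psd \<rho>" "mat_trace \<rho> \<le> 1"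
    using assms by (auto simp: qstate_iff)
  have m: "1 \<le> m" "m \<le> qdim \<rho>" using m by auto
  show "qdim (project m i \<rho>) = qdim \<rho> - 1"
    using project_carrier[OF \<rho>(1) m] by (rule qdim_carrier)
  \<comment> \<open>Nonnegativity for both outcomes bounds each trace by their sum, the trace of
    \<rho>.\<close>
  have "0 \<le> mat_trace (project m k \<rho>)" for k
    using psd_project[OF \<rho>(1) m \<rho>(2)] by (rule mat_trace_psd_nonneg)
  then have "mat_trace (project m 0 \<rho>) \<le> mat_trace \<rho>" "mat_trace (project m 1 \<rho>) \<le> mat_trace \<rho>"
    using mat_trace_project[OF \<rho>(1) m] by (metis add_increasing add_increasing2 order_refl)+
  moreover have "i = 0 \<or> i = 1" using i by auto
  ultimately have "mat_trace (project m i \<rho>) \<le> 1" using \<rho>(3) by (auto intro: order_trans)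
  then show "qstate (project m i \<rho>)"
    using project_carrier[OF \<rho>(1) m] psd_project[OF \<rho>(1) m \<rho>(2)] by (intro qstateI)
qed

lemma qstate_ptrace1:
  assumes \<rho>: "qstate \<rho>" and m: "m \<in> {1..qdim \<rho>}"
  shows "qstate (ptrace1 m \<rho>)" "qdim (ptrace1 m \<rho>) = qdim \<rho> - 1"
proof -
  have \<rho>: "\<rho> \<in> carrier_mat (2 ^ qdim \<rho>) (2 ^ qdim \<rho>)" "psd \<rho>" "mat_trace \<rho> \<le> 1"
    using assms by (auto simp: qstate_iff)
  have m: "1 \<le> m" "m \<le> qdim \<rho>" using m by auto
  note pc = project_carrier[OF \<rho>(1) m]
  have c: "ptrace1 m \<rho> \<in> carrier_mat (2 ^ (qdim \<rho> - 1)) (2 ^ (qdim \<rho> - 1))"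
    using pc by (simp add: ptrace1_def)
  then show "qdim (ptrace1 m \<rho>) = qdim \<rho> - 1" by (rule qdim_carrier)
  show "qstate (ptrace1 m \<rho>)"
    using c
  proof (rule qstateI)
    show "psd (ptrace1 m \<rho>)"
      unfolding ptrace1_def using pc pc psd_project[OF \<rho>(1) m \<rho>(2)] psd_project[OF \<rho>(1) m \<rho>(2)]
      by (rule psd_add)
    show "mat_trace (ptrace1 m \<rho>) \<le> 1"
      unfolding ptrace1_def mat_trace_add[OF pc pc] mat_trace_project[OF \<rho>(1) m] by (rule \<rho>(3))
  qed
qed

text \<open>\<open>foldr\<close> traces out the largest qubit first. The invariant to check is that
  the next, smaller number still names a qubit of the shrunken state.\<close>

lemma qstate_foldr_ptrace1:
  assumes "qstate \<rho>" "sorted ms" "distinct ms" "set ms \<subseteq> {1..qdim \<rho>}"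
  shows "qstate (foldr ptrace1 ms \<rho>) \<and> qdim (foldr ptrace1 ms \<rho>) = qdim \<rho> - length ms"
  using assms
proof (induction ms)
  case (Cons m ms)
  then have IH: "qstate (foldr ptrace1 ms \<rho>)" "qdim (foldr ptrace1 ms \<rho>) = qdim \<rho> - length ms"
    by auto
  \<comment> \<open>Counting distinct numbers in this interval gives
    \<open>m \<le> qdim \<rho> - length ms\<close>.\<close>
  have "set (m # ms) \<subseteq> {m..qdim \<rho>}" using Cons.prems by auto
  then have "length (m # ms) \<le> Suc (qdim \<rho>) - m"
    using Cons.prems by (metis card_atLeastAtMost card_mono distinct_card finite_atLeastAtMost)
  then have "m \<in> {1..qdim (foldr ptrace1 ms \<rho>)}" using Cons.prems IH by auto
  from qstate_ptrace1[OF IH(1) this] show ?case using IH(2) by simp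
qed simp

lemma qstate_ptrace:
  assumes "qstate \<rho>" "Q \<subseteq> {1..qdim \<rho>}"
  shows "qstate (ptrace Q \<rho>)" "qdim (ptrace Q \<rho>) = qdim \<rho> - card Q"
proof -
  have "finite Q" using assms(2) finite_subset by blast
  then show "qstate (ptrace Q \<rho>)" "qdim (ptrace Q \<rho>) = qdim \<rho> - card Q"
    using qstate_foldr_ptrace1[OF assms(1), of "sorted_list_of_set Q"] assms(2)
    by (simp_all add: ptrace_def)
qed

section \<open>Gates on selected qubits\<close>

lemma gate_at_carrier [simp]: "gate_at N ms S \<in> carrier_mat (2 ^ N) (2 ^ N)"
  by (simp add: gate_at_def)

text \<open>The head of \<open>ms\<close> is the leftmost factor and so the highest digit; digit
  \<open>k\<close> therefore belongs to entry \<open>k\<close> of the reversed list.\<close>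

lemma bit_select_iff:
  "bit (select N ms i) k \<longleftrightarrow> k < length ms \<and> qubit_of N i (rev ms ! k)"
  by (auto simp: select_def bit_horner_sum_bit_iff rev_map)

lemma select_less: "select N ms i < 2 ^ length ms"
  unfolding select_def using horner_sum_of_bool_2_less[of "rev (map (qubit_of N i) ms)"] by simp

lemma select_eq_iff:
  "select N ms i = select N ms j \<longleftrightarrow> (\<forall>m \<in> set ms. qubit_of N i m = qubit_of N j m)"
proof -
  have "select N ms i = select N ms j
      \<longleftrightarrow> (\<forall>k<length ms. qubit_of N i (rev ms ! k) = qubit_of N j (rev ms ! k))"
    by (auto simp: bit_eq_iff bit_select_iff)
  also have "\<dots> \<longleftrightarrow> (\<forall>m \<in> set (rev ms). qubit_of N i m = qubit_of N j m)"
    unfolding all_set_conv_all_nth by simp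
  finally show ?thesis by simp
qed

text \<open>For \<open>k < N\<close>, qubit \<open>N - k\<close> is the digit of weight
  \<open>2 ^ k\<close>; the digits from position \<open>N\<close> on vanish by the two
  bounds.\<close>

lemma eq_qubits:
  assumes "i < 2 ^ N" "j < 2 ^ N" "\<And>m. m \<in> {1..N} \<Longrightarrow> qubit_of N i m = qubit_of N j m"
  shows "i = j"
proof (rule bit_eqI)
  fix k
  show "bit i k = bit j k"
  proof (cases "k < N")
    case True
    then show ?thesis using assms(3)[of "N - k"] by (simp add: qubit_of_def)
  next
    case False
    then show ?thesis using assms(1,2) by (metis bit_take_bit_iff take_bit_nat_eq_self)
  qed
qed

lemma ex_qubits: "\<exists>i < 2 ^ N. \<forall>m \<in> {1..N}. qubit_of N i m = g m"
proof (intro exI conjI ballI)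
  \<comment> \<open>Digit \<open>k\<close> of the witness is the prescribed value of qubit
    \<open>N - k\<close>.\<close>
  let ?i = "horner_sum of_bool 2 (map (\<lambda>k. g (N - k)) [0..<N]) :: nat"
  show "?i < 2 ^ N" using horner_sum_of_bool_2_less[of "map (\<lambda>k. g (N - k)) [0..<N]"] by simp
  show "qubit_of N ?i m = g m" if "m \<in> {1..N}" for m
    using that by (simp add: qubit_of_def bit_horner_sum_bit_iff)
qed

text \<open>Once the qubits outside of \<open>ms\<close> are fixed, \<open>select N ms\<close> is a bijection onto the
  indices of the rows of a gate, so that a column of \<open>gate_at\<close> has the norm of a column of the gate.\<close>

lemma bij_betw_select:
  assumes "distinct ms" "set ms \<subseteq> {1..N}"
  shows "bij_betw (select N ms)
    {i. i < 2 ^ N \<and> (\<forall>m \<in> {1..N} - set ms. qubit_of N i m = qubit_of N j m)} {..<2 ^ length ms}"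
    (is "bij_betw _ ?A _")
proof (rule bij_betwI')
  fix x y assume "x \<in> ?A" "y \<in> ?A"
  then have xy: "x < 2 ^ N" "y < 2 ^ N"
    "\<forall>m \<in> {1..N} - set ms. qubit_of N x m = qubit_of N y m" by simp_all
  have "x = y" if "\<forall>m \<in> set ms. qubit_of N x m = qubit_of N y m"
    by (rule eq_qubits[OF xy(1,2)]) (use xy(3) that in blast)
  then show "(select N ms x = select N ms y) \<longleftrightarrow> x = y"
    by (auto simp: select_eq_iff)
next
  fix s :: nat assume s: "s \<in> {..<2 ^ length ms}"
  \<comment> \<open>The preimage of \<open>s\<close> takes the digits of \<open>s\<close> on the
    qubits in \<open>ms\<close> and agrees with \<open>j\<close> elsewhere. The position
    \<open>k\<close> of a qubit in \<open>rev ms\<close> is unique by distinctness.\<close>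
  let ?g = "\<lambda>m. if m \<in> set ms then \<exists>k<length ms. rev ms ! k = m \<and> bit s k else qubit_of N j m"
  obtain i where i: "i < 2 ^ N" "\<forall>m \<in> {1..N}. qubit_of N i m = ?g m"
    using ex_qubits[of N ?g] by blast
  have "s = select N ms i"
  proof (rule bit_eqI)
    fix k
    show "bit s k = bit (select N ms i) k"
    proof (cases "k < length ms")
      case True
      then have mem: "rev ms ! k \<in> set ms" by (metis length_rev nth_mem set_rev)
      then have "qubit_of N i (rev ms ! k)
          \<longleftrightarrow> (\<exists>k'<length ms. rev ms ! k' = rev ms ! k \<and> bit s k')"
        using i(2) assms(2) by auto
      also have "\<dots> \<longleftrightarrow> bit s k"
        using True assms(1) by (metis distinct_rev length_rev nth_eq_iff_index_eq)
      finally show ?thesis using True by (simp add: bit_select_iff)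
    next
      case False
      \<comment> \<open>Digits of \<open>s\<close> beyond \<open>length ms\<close> vanish because
        \<open>s < 2 ^ length ms\<close>.\<close>
      then show ?thesis using s
        by (metis bit_select_iff bit_take_bit_iff lessThan_iff take_bit_nat_eq_self)
    qed
  qed
  with i show "\<exists>i \<in> ?A. s = select N ms i" by auto
qed (simp add: select_less)

text \<open>An entry is the inner product of two columns. It vanishes unless \<open>a\<close> and
  \<open>b\<close> agree outside \<open>ms\<close>; otherwise reindexing by \<open>select\<close>
  turns it into an entry of the adjoint of \<open>S\<close> times \<open>S\<close>.\<close>

lemma gate_at_isometry:
  assumes S: "unitary_mat (2 ^ length ms) S" and ms: "distinct ms" "set ms \<subseteq> {1..N}"
  shows "mat_adjoint (gate_at N ms S) * gate_at N ms S = 1\<^sub>m (2 ^ N)"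
proof (rule eq_matI)
  let ?U = "gate_at N ms S" and ?n = "2 ^ length ms :: nat"
  let ?off = "\<lambda>i j. \<forall>m \<in> {1..N} - set ms. qubit_of N i m = qubit_of N j m"
  fix a b assume "a < dim_row (1\<^sub>m (2 ^ N) :: complex mat)" "b < dim_col (1\<^sub>m (2 ^ N) :: complex mat)"
  then have ab: "a < 2 ^ N" "b < 2 ^ N" by auto
  have S': "S \<in> carrier_mat ?n ?n" "mat_adjoint S * S = 1\<^sub>m ?n"
    using S by (auto simp: unitary_mat_def)
  have *: "(\<Sum>s<?n. cnj (S $$ (s, x)) * S $$ (s, y)) = of_bool (x = y)" if "x < ?n" "y < ?n" for x y
  proof -
    have "(\<Sum>s<?n. cnj (S $$ (s, x)) * S $$ (s, y)) = (mat_adjoint S * S) $$ (x, y)"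
      using S'(1) that by (auto simp: scalar_prod_def lessThan_atLeast0 intro!: sum.cong)
    then show ?thesis using S'(2) that by simp
  qed
  have "(mat_adjoint ?U * ?U) $$ (a, b) = (\<Sum>i<2 ^ N. cnj (?U $$ (i, a)) * ?U $$ (i, b))"
    using ab by (auto simp: scalar_prod_def lessThan_atLeast0 gate_at_def intro!: sum.cong)
  \<comment> \<open>Once \<open>i\<close> agrees with \<open>a\<close> outside \<open>ms\<close>,
    agreement of \<open>i\<close> with \<open>b\<close> there becomes agreement of \<open>a\<close>
    with \<open>b\<close>, a condition free of \<open>i\<close>.\<close>
  also have "\<dots> = (\<Sum>i<2 ^ N. if ?off i a then
      (if ?off a b then cnj (S $$ (select N ms i, select N ms a)) * S $$ (select N ms i, select N ms b)
       else 0) else 0)"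
    using ab by (intro sum.cong) (auto simp: gate_at_def)
  also have "\<dots> = (\<Sum>i \<in> {i. i < 2 ^ N \<and> ?off i a}. 
      if ?off a b then cnj (S $$ (select N ms i, select N ms a)) * S $$ (select N ms i, select N ms b)
       else 0)"
    by (simp add: sum.If_cases Int_def lessThan_def del: Diff_iff)
  also have "\<dots> = (\<Sum>s<?n. 
      if ?off a b then cnj (S $$ (s, select N ms a)) * S $$ (s, select N ms b) else 0)"
    by (rule sum.reindex_bij_betw[OF bij_betw_select[OF ms, of a]])
  also have "\<dots> = of_bool (?off a b \<and> select N ms a = select N ms b)"
  proof (cases "?off a b")
    case True
    show ?thesis unfolding if_P[OF True] *[OF select_less select_less] using True by simp
  next
    case False
    show ?thesis unfolding if_not_P[OF False] using False by simp
  qed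
  \<comment> \<open>Agreement outside \<open>ms\<close> and equal selected digits together mean
    agreement on all qubits.\<close>
  also have "(?off a b \<and> select N ms a = select N ms b) \<longleftrightarrow> a = b"
    unfolding select_eq_iff using eq_qubits[OF ab] by blast
  finally show "(mat_adjoint ?U * ?U) $$ (a, b) = 1\<^sub>m (2 ^ N) $$ (a, b)"
    using ab by simp
qed (simp_all add: gate_at_def)

lemma qstate_apply_gate:
  assumes \<rho>: "qstate \<rho>"
    and S: "unitary_mat (2 ^ length ms) S" and ms: "distinct ms" "set ms \<subseteq> {1..qdim \<rho>}"
  shows "qstate (apply_gate ms S \<rho>)" "qdim (apply_gate ms S \<rho>) = qdim \<rho>"
proof -
  define N where "N = qdim \<rho>"
  let ?d = "2 ^ N :: nat" and ?U = "gate_at N ms S"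
  have \<rho>: "\<rho> \<in> carrier_mat ?d ?d" "psd \<rho>" "mat_trace \<rho> \<le> 1"
    using assms by (auto simp: qstate_iff N_def)
  have eq: "apply_gate ms S \<rho> = ?U * \<rho> * mat_adjoint ?U" by (simp add: apply_gate_def N_def)
  have U: "?U \<in> carrier_mat ?d ?d" "mat_adjoint ?U \<in> carrier_mat ?d ?d" by auto
  have U\<rho>: "?U * \<rho> \<in> carrier_mat ?d ?d" using U(1) \<rho>(1) by (rule mult_carrier_mat)
  have c: "apply_gate ms S \<rho> \<in> carrier_mat ?d ?d"
    unfolding eq using U\<rho> U(2) by (rule mult_carrier_mat)
  then show "qdim (apply_gate ms S \<rho>) = qdim \<rho>" unfolding N_def by (rule qdim_carrier)
  \<comment> \<open>Cyclicity of the trace brings the gate next to its adjoint, where the isometry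
    property cancels them.\<close>
  have "mat_trace (apply_gate ms S \<rho>) = mat_trace (mat_adjoint ?U * (?U * \<rho>))"
    unfolding eq using U\<rho> U(2) by (rule mat_trace_mult_commute)
  also have "mat_adjoint ?U * (?U * \<rho>) = mat_adjoint ?U * ?U * \<rho>"
    using assoc_mult_mat[OF U(2,1) \<rho>(1)] by (rule sym)
  also have "\<dots> = \<rho>"
    unfolding gate_at_isometry[OF S ms, folded N_def] using \<rho>(1) by (rule left_mult_one_mat)
  finally have "mat_trace (apply_gate ms S \<rho>) \<le> 1" using \<rho>(3) by simp
  moreover have "psd (apply_gate ms S \<rho>)"
    using psd_congruence[OF \<rho>(1,2) U(2)] by (simp add: eq)
  ultimately show "qstate (apply_gate ms S \<rho>)" using c by (intro qstateI)
qed

section \<open>Typing\<close>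

declare fun_upd_apply [simp del] fun_upd_same [simp] fun_upd_other [simp]

lemma wf_lift_ty: "\<lbrakk>wf_ty n B; k \<le> n\<rbrakk> \<Longrightarrow> wf_ty (Suc n) (lift_ty k B)"
  by (induction B arbitrary: n k) auto

text \<open>Passing under \<open>Mu\<close> raises \<open>n\<close> and \<open>k\<close> and lifts
  \<open>B\<close>, so all three vary in the induction.\<close>

lemma wf_subst_ty: "\<lbrakk>wf_ty (Suc n) A; wf_ty n B; k \<le> n\<rbrakk> \<Longrightarrow> wf_ty n (subst_ty A k B)"
  by (induction A arbitrary: n k B) (auto simp: wf_lift_ty)

lemma closed_unroll: "closed_ty (Mu A) \<Longrightarrow> closed_ty (unroll A)"
  by (simp add: unroll_def wf_subst_ty)

lemma classical_lift_ty [simp]: "classical (lift_ty k B) \<longleftrightarrow> classical B"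
  by (induction B arbitrary: k) auto

lemma classical_subst_ty: "\<lbrakk>classical A; classical B\<rbrakk> \<Longrightarrow> classical (subst_ty A k B)"
  by (induction A arbitrary: k B) auto

lemma classical_unroll: "classical A \<Longrightarrow> classical (unroll A)"
  by (simp add: unroll_def classical_subst_ty)

lemma wf_vctx_iff: "wf_vctx \<Gamma> \<longleftrightarrow> finite (dom \<Gamma>) \<and> (\<forall>x A. \<Gamma> x = Some A \<longrightarrow> closed_ty A)"
  by (auto simp: wf_vctx_def ran_def)

lemma wf_pctx_iff:
  "wf_pctx \<Phi> \<longleftrightarrow> finite (dom \<Phi>) \<and> (\<forall>f A B. \<Phi> f = Some (A, B) \<longrightarrow> closed_ty A \<and> closed_ty B)"
  by (auto simp: wf_pctx_def ran_def)

lemma wf_vctx_upd [simp]: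
  "x \<notin> dom \<Gamma> \<Longrightarrow> wf_vctx (\<Gamma>(x \<mapsto> A)) \<longleftrightarrow> wf_vctx \<Gamma> \<and> closed_ty A"
  by (auto simp: wf_vctx_def domIff)

lemma wf_pctx_upd: "\<lbrakk>wf_pctx \<Phi>; closed_ty A; closed_ty B\<rbrakk> \<Longrightarrow> wf_pctx (\<Phi>(f \<mapsto> (A, B)))"
  by (auto simp: wf_pctx_iff fun_upd_apply)

lemma wf_pctx_updD: "wf_pctx (\<Phi>(f \<mapsto> (A, B))) \<Longrightarrow> closed_ty A \<and> closed_ty B"
  by (metis fun_upd_same wf_pctx_iff)

section \<open>Well-formedness, weakening and renaming of typing derivations\<close>

text \<open>\<open>Seq\<close>, \<open>While\<close> and \<open>Case\<close> inherit well-formedness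
  from their typing premises. \<open>Fold\<close> and \<open>Unfold\<close> rely on unrolling a
  closed type, and \<open>Call\<close> finds its result type closed in the procedure
  context.\<close>

lemma typing_wf:
  "typing \<Phi> \<Gamma> M \<Sigma> \<Longrightarrow> wf_pctx \<Phi> \<and> wf_vctx \<Gamma> \<and> wf_vctx \<Sigma>"
proof (induction rule: typing.induct)
  case (Call \<Phi> \<Gamma> f A B x y)
  then show ?case by (auto simp: wf_ctxs_def wf_pctx_iff)
qed (auto simp: wf_ctxs_def closed_unroll)

text \<open>In the \<open>Proc\<close> case both contexts are updated at the same name, which
  preserves \<open>\<subseteq>\<^sub>m\<close> even if the larger one already contains that name;
  here shadowing matters.\<close>

lemma typing_weaken:
  "\<lbrakk>typing \<Phi> \<Gamma> M \<Sigma>; \<Phi> \<subseteq>\<^sub>m \<Phi>'; wf_pctx \<Phi>'\<rbrakk> \<Longrightarrow> typing \<Phi>' \<Gamma> M \<Sigma>"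
proof (induction arbitrary: \<Phi>' rule: typing.induct)
  case (Proc \<Phi> \<Gamma> f A B x M y)
  have "wf_pctx (\<Phi>(f \<mapsto> (A, B)))" using typing_wf Proc.hyps(2) by blast
  then have "wf_pctx (\<Phi>'(f \<mapsto> (A, B)))" using Proc.prems(2) wf_pctx_updD wf_pctx_upd by blast
  then show ?case using Proc map_le_upd[OF Proc.prems(1)]
    by (intro typing.Proc) (auto simp: wf_ctxs_def)
next
  case (Call \<Phi> \<Gamma> f A B x y)
  then have "\<Phi>' f = Some (A, B)" by (metis domI map_le_def)
  then show ?case using Call by (intro typing.Call) (auto simp: wf_ctxs_def)
qed (auto intro: typing.intros simp: wf_ctxs_def)

text \<open>Renaming along \<open>\<sigma>\<close> and extension by the frame \<open>\<Delta>\<close> are combined, so that one induction on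
  typing derivations handles both; in a nested procedure body the frame is empty.\<close>

definition rename_ctx :: "(var \<Rightarrow> var) \<Rightarrow> var set \<Rightarrow> vctx \<Rightarrow> vctx \<Rightarrow> vctx" where
  "rename_ctx \<sigma> W \<Delta> \<Gamma> z = (if z \<in> \<sigma> ` W then \<Gamma> (inv_into W \<sigma> z) else \<Delta> z)"

lemma rename_ctx_apply [simp]: "\<lbrakk>inj_on \<sigma> W; x \<in> W\<rbrakk> \<Longrightarrow> rename_ctx \<sigma> W \<Delta> \<Gamma> (\<sigma> x) = \<Gamma> x"
  by (simp add: rename_ctx_def)

lemma dom_rename_ctx_iff [simp]:
  "\<lbrakk>inj_on \<sigma> W; x \<in> W\<rbrakk> \<Longrightarrow> \<sigma> x \<in> dom (rename_ctx \<sigma> W \<Delta> \<Gamma>) \<longleftrightarrow> x \<in> dom \<Gamma>"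
  by (simp add: domIff)

lemma rename_ctx_upd [simp]:
  "\<lbrakk>inj_on \<sigma> W; x \<in> W\<rbrakk>
    \<Longrightarrow> rename_ctx \<sigma> W \<Delta> (\<Gamma>(x \<mapsto> A)) = (rename_ctx \<sigma> W \<Delta> \<Gamma>)(\<sigma> x \<mapsto> A)"
  by (rule ext) (auto simp: rename_ctx_def inj_on_eq_iff fun_upd_apply)

text \<open>Together with \<open>rename_ctx_upd\<close> this turns the renamed one-variable context
  of a procedure body into the frame plus one entry, the form required at a call.\<close>

lemma rename_ctx_empty: "\<forall>x \<in> W. \<sigma> x \<notin> dom \<Delta> \<Longrightarrow> rename_ctx \<sigma> W \<Delta> Map.empty = \<Delta>"
  by (rule ext) (auto simp: rename_ctx_def domIff)

lemma wf_rename_ctx: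
  assumes "wf_vctx \<Gamma>" "wf_vctx \<Delta>" "inj_on \<sigma> W"
  shows "wf_vctx (rename_ctx \<sigma> W \<Delta> \<Gamma>)"
proof -
  have "dom (rename_ctx \<sigma> W \<Delta> \<Gamma>) \<subseteq> \<sigma> ` dom \<Gamma> \<union> dom \<Delta>"
  proof
    fix z assume z: "z \<in> dom (rename_ctx \<sigma> W \<Delta> \<Gamma>)"
    show "z \<in> \<sigma> ` dom \<Gamma> \<union> dom \<Delta>"
    proof (cases "z \<in> \<sigma> ` W")
      case True
      then obtain x where "x \<in> W" "z = \<sigma> x" by blast
      then show ?thesis using z assms(3) by simp
    next
      case False
      then show ?thesis using z by (simp add: domIff rename_ctx_def)
    qed
  qed
  then show ?thesis
    using assms by (auto simp: wf_vctx_iff rename_ctx_def finite_subset split: if_splits)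
qed

text \<open>A fixed set \<open>W\<close> containing all variables of the term lets the same
  injectivity assumption serve every subterm. The frame varies in the induction because nested
  procedure bodies need another one.\<close>

lemma typing_rename:
  "\<lbrakk>typing \<Phi> \<Gamma> M \<Sigma>; vars M \<subseteq> W; inj_on \<sigma> W; wf_vctx \<Delta>\<rbrakk>
    \<Longrightarrow> typing \<Phi> (rename_ctx \<sigma> W \<Delta> \<Gamma>) (rename \<sigma> M) (rename_ctx \<sigma> W \<Delta> \<Sigma>)"
proof (induction arbitrary: \<Delta> rule: typing.induct)
  case (Copy \<Phi> \<Gamma> x y P)
  then show ?case
    using typing.Copy[of \<Phi> "rename_ctx \<sigma> W \<Delta> \<Gamma>" "\<sigma> x" "\<sigma> y" P]
    by (auto simp: wf_ctxs_def wf_rename_ctx inj_on_eq_iff)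
next
  case (Gate \<Phi> \<Gamma> qs S)
  then have "distinct (map \<sigma> qs)" by (simp add: distinct_map inj_on_subset)
  moreover have "\<forall>q \<in> set (map \<sigma> qs). rename_ctx \<sigma> W \<Delta> \<Gamma> q = Some Qbit"
    using Gate by auto
  ultimately show ?case
    using Gate typing.Gate[of \<Phi> "rename_ctx \<sigma> W \<Delta> \<Gamma>" "map \<sigma> qs" S]
    by (simp add: wf_ctxs_def wf_rename_ctx)
next
  case (Case y \<Gamma> x1 x2 \<Phi> A M1 \<Sigma> B M2)
  then have "typing \<Phi> ((rename_ctx \<sigma> W \<Delta> \<Gamma>)(\<sigma> x1 \<mapsto> A)) (rename \<sigma> M1) (rename_ctx \<sigma> W \<Delta> \<Sigma>)"
    "typing \<Phi> ((rename_ctx \<sigma> W \<Delta> \<Gamma>)(\<sigma> x2 \<mapsto> B)) (rename \<sigma> M2) (rename_ctx \<sigma> W \<Delta> \<Sigma>)"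
    using Case.IH[of \<Delta>] by auto
  then show ?case using Case.hyps Case.prems by (auto intro!: typing.Case)
next
  case (Pair \<Phi> \<Gamma> x1 x2 A x B)
  then show ?case
    using typing.Pair[of \<Phi> "rename_ctx \<sigma> W \<Delta> \<Gamma>" "\<sigma> x1" "\<sigma> x2" A "\<sigma> x" B]
    by (auto simp: wf_ctxs_def wf_rename_ctx inj_on_eq_iff)
next
  case (Unpair \<Phi> \<Gamma> x1 x2 A x B)
  then show ?case
    using typing.Unpair[of \<Phi> "rename_ctx \<sigma> W \<Delta> \<Gamma>" "\<sigma> x1" "\<sigma> x2" A "\<sigma> x" B]
    by (auto simp: wf_ctxs_def wf_rename_ctx inj_on_eq_iff)
next
  case (Proc \<Phi> \<Gamma> f A B x M y)
  \<comment> \<open>The body of a nested definition sees its parameter alone, so the induction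
    hypothesis is used with the empty frame.\<close>
  have "wf_vctx Map.empty" by (simp add: wf_vctx_def)
  with Proc have "typing (\<Phi>(f \<mapsto> (A, B))) [\<sigma> x \<mapsto> A] (rename \<sigma> M) [\<sigma> y \<mapsto> B]"
    using Proc.IH[of Map.empty] by (auto simp: rename_ctx_empty)
  then show ?case using Proc by (auto simp: wf_ctxs_def wf_rename_ctx intro!: typing.Proc)
qed (auto intro!: typing.intros simp: wf_ctxs_def wf_rename_ctx)

section \<open>Values and the renumbering of pointers\<close>

inductive_cases val_typing_elims:
  "val_typing Q VUnit A" "val_typing Q (VPtr n) A" "val_typing Q (VLeft B C v) A"
  "val_typing Q (VRight B C v) A" "val_typing Q (VPair v w) A" "val_typing Q (VFold B v) A"

text \<open>The annotations on \<open>VLeft\<close>, \<open>VRight\<close> and \<open>VFold\<close>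
  supply what the inner value does not reveal. This identifies the pointer set named in the discard
  rule with the one used by the assignment.\<close>

lemma val_typing_unique:
  "\<lbrakk>val_typing Q v A; val_typing Q' v A'\<rbrakk> \<Longrightarrow> Q' = Q \<and> A' = A"
proof (induction arbitrary: Q' A' rule: val_typing.induct)
  case (VPair Q1 v A Q2 w B)
  from VPair.prems show ?case by (rule val_typing_elims) (use VPair.IH in blast)
qed (blast elim: val_typing_elims)+

text \<open>Unrolling keeps a type classical, so the pointer rule never applies. Copying such a
  value thus duplicates no qubit.\<close>

lemma val_typing_classical: "\<lbrakk>val_typing Q v A; classical A\<rbrakk> \<Longrightarrow> Q = {}"
  by (induction rule: val_typing.induct) (auto simp: classical_unroll)

abbreviation reindex_ptr :: "nat set \<Rightarrow> nat \<Rightarrow> nat" where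
  "reindex_ptr P k \<equiv> k - card {i \<in> P. i < k}"

text \<open>Injectivity keeps the pointer sets of the two components of a pair disjoint.\<close>

lemma val_typing_reindex:
  "\<lbrakk>val_typing Q v A; inj_on (reindex_ptr P) Q\<rbrakk>
    \<Longrightarrow> val_typing (reindex_ptr P ` Q) (reindex P v) A"
proof (induction rule: val_typing.induct)
  case (VPair Q1 v A Q2 w B)
  have "reindex_ptr P ` Q1 \<inter> reindex_ptr P ` Q2 = {}"
    using VPair.hyps(3) inj_on_image_Int[OF VPair.prems, of Q1 Q2] by simp
  then show ?case using VPair by (simp add: image_Un inj_on_Un val_typing.VPair)
next
  case (VPtr n)
  show ?case using val_typing.VPtr by simp
qed (simp_all add: val_typing.intros)

lemma reindex_ptr_bij:
  assumes "P \<subseteq> {1..N}"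
  shows "inj_on (reindex_ptr P) ({1..N} - P)"
    and "reindex_ptr P ` ({1..N} - P) = {1..N - card P}"
proof -
  have fin: "finite P" using assms finite_subset by blast
  \<comment> \<open>The new number of a surviving qubit is its rank among the survivors;
    \<open>Suc\<close> appears because numbering starts at 1.\<close>
  have eq: "reindex_ptr P k = Suc (card {i \<in> {1..N} - P. i < k})" if "k \<in> {1..N} - P" for k
  proof -
    have "{1..<k} = {i \<in> P. i < k} \<union> {i \<in> {1..N} - P. i < k}" using assms that by auto
    then have "card {1..<k} = card {i \<in> P. i < k} + card {i \<in> {1..N} - P. i < k}"
      using fin by (simp add: card_Un_disjoint disjoint_iff)
    then show ?thesis using that by auto
  qed
  have mono: "reindex_ptr P k < reindex_ptr P l"
    if "k \<in> {1..N} - P" "l \<in> {1..N} - P" "k < l" for k l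
  proof -
    have "k \<in> {i \<in> {1..N} - P. i < l}" "k \<notin> {i \<in> {1..N} - P. i < k}"
      using that by simp_all
    moreover have "{i \<in> {1..N} - P. i < k} \<subseteq> {i \<in> {1..N} - P. i < l}" using that(3) by auto
    ultimately have "{i \<in> {1..N} - P. i < k} \<subset> {i \<in> {1..N} - P. i < l}" by blast
    then have "card {i \<in> {1..N} - P. i < k} < card {i \<in> {1..N} - P. i < l}"
      by (intro psubset_card_mono) auto
    then show ?thesis using eq that by simp
  qed
  show inj: "inj_on (reindex_ptr P) ({1..N} - P)"
  proof (rule linorder_inj_onI')
    fix k l assume "k \<in> {1..N} - P" "l \<in> {1..N} - P" "k < l"
    from mono[OF this] show "reindex_ptr P k \<noteq> reindex_ptr P l" by linarith
  qed
  have card: "card ({1..N} - P) = N - card P"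
    using assms fin by (simp add: card_Diff_subset)
  have "reindex_ptr P k \<in> {1..N - card P}" if k: "k \<in> {1..N} - P" for k
  proof -
    have "k \<notin> {i \<in> {1..N} - P. i < k}" by simp
    with k have "{i \<in> {1..N} - P. i < k} \<subset> {1..N} - P" by blast
    then have "card {i \<in> {1..N} - P. i < k} < card ({1..N} - P)"
      by (intro psubset_card_mono) auto
    then show ?thesis using eq[OF k] card by simp
  qed
  \<comment> \<open>The image lies in the interval and, by injectivity, has as many elements, so it
    is the whole interval.\<close>
  then show "reindex_ptr P ` ({1..N} - P) = {1..N - card P}"
    using card card_image[OF inj] by (intro card_subset_eq) auto
qed

section \<open>Typing of assignments\<close>

lemma assignment_typing_dom: "assignment_typing Q \<Gamma> V \<Longrightarrow> dom V = dom \<Gamma>"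
  by (simp add: assignment_typing_def)

lemma assignment_typing_updI:
  assumes "assignment_typing Q2 \<Gamma> V" "val_typing Q1 v A" "Q1 \<inter> Q2 = {}" "x \<notin> dom \<Gamma>"
  shows "assignment_typing (Q1 \<union> Q2) (\<Gamma>(x \<mapsto> A)) (V(x \<mapsto> v))"
proof -
  from assms(1) obtain R where dom: "dom V = dom \<Gamma>"
    and R: "\<forall>y \<in> dom V. val_typing (R y) (the (V y)) (the (\<Gamma> y))"
      "disjoint_family_on R (dom V)" "Q2 = (\<Union>y \<in> dom V. R y)"
    by (auto simp: assignment_typing_def)
  have x: "x \<notin> dom V" using assms(4) dom by simp
  let ?R = "R(x := Q1)"
  have "\<forall>y \<in> insert x (dom V).
      val_typing (?R y) (the ((V(x \<mapsto> v)) y)) (the ((\<Gamma>(x \<mapsto> A)) y))"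
    using R(1) assms(2) x by (auto simp: fun_upd_apply)
  moreover have "disjoint_family_on ?R (insert x (dom V))"
    unfolding disjoint_family_on_def
  proof (intro ballI impI)
    fix m n assume "m \<in> insert x (dom V)" "n \<in> insert x (dom V)" "m \<noteq> n"
    then consider "m = x" "n \<in> dom V" "n \<noteq> x" | "n = x" "m \<in> dom V" "m \<noteq> x"
      | "m \<noteq> x" "n \<noteq> x" "m \<in> dom V" "n \<in> dom V" by blast
    then show "?R m \<inter> ?R n = {}"
    proof cases
      case 1
      then show ?thesis using R(3) assms(3) by simp blast
    next
      case 2
      then show ?thesis using R(3) assms(3) by simp blast
    next
      case 3
      then show ?thesis using R(2) \<open>m \<noteq> n\<close> by (simp add: disjoint_family_on_def)
    qed
  qed
  moreover have "Q1 \<union> Q2 = (\<Union>y \<in> insert x (dom V). ?R y)"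
    using R(3) x by (auto simp: fun_upd_apply)
  moreover have "dom (V(x \<mapsto> v)) = insert x (dom V)" "dom (\<Gamma>(x \<mapsto> A)) = insert x (dom V)"
    using dom by simp_all
  ultimately show ?thesis
    unfolding assignment_typing_def by metis
qed

text \<open>From the family of pointer sets the member at \<open>x\<close> is split off; the union
  of the others serves the rest of the assignment.\<close>

lemma assignment_typing_updE:
  assumes "assignment_typing Q (\<Gamma>(x \<mapsto> A)) (V(x \<mapsto> v))" "x \<notin> dom \<Gamma>" "x \<notin> dom V"
  obtains Q1 Q2 where "val_typing Q1 v A" "assignment_typing Q2 \<Gamma> V" "Q1 \<inter> Q2 = {}" "Q = Q1 \<union> Q2"
proof -
  have ins: "dom (V(x \<mapsto> v)) = insert x (dom V)" by simp
  obtain R where dom: "insert x (dom V) = dom (\<Gamma>(x \<mapsto> A))"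
    and R: "\<forall>y \<in> insert x (dom V).
        val_typing (R y) (the ((V(x \<mapsto> v)) y)) (the ((\<Gamma>(x \<mapsto> A)) y))"
      "disjoint_family_on R (insert x (dom V))" "Q = (\<Union>y \<in> insert x (dom V). R y)"
    using assms(1) unfolding assignment_typing_def ins by blast
  have dom: "dom V = dom \<Gamma>" using dom assms(2,3) by auto
  have "val_typing (R y) (the (V y)) (the (\<Gamma> y))" if "y \<in> dom V" for y
    using R(1) that assms(3) by (metis fun_upd_other insertI2)
  then have "assignment_typing (\<Union>y \<in> dom V. R y) \<Gamma> V"
    using dom R(2) unfolding assignment_typing_def
    by (intro conjI exI[of _ R]) (auto simp: disjoint_family_on_def)
  moreover have "val_typing (R x) v A" using bspec[OF R(1), of x] by simp
  moreover have "R x \<inter> R y = {}" if "y \<in> dom V" for y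
    using R(2) by (rule disjoint_family_onD) (use assms(3) that in auto)
  then have "R x \<inter> (\<Union>y \<in> dom V. R y) = {}" by blast
  moreover have "Q = R x \<union> (\<Union>y \<in> dom V. R y)" using R(3) by simp
  ultimately show ?thesis using that by blast
qed

lemma assignment_typing_unique:
  assumes "assignment_typing Q \<Gamma> V" "assignment_typing Q' \<Gamma>' V"
  shows "\<Gamma>' = \<Gamma>"
proof
  fix x
  note d = assignment_typing_dom[OF assms(1)] assignment_typing_dom[OF assms(2)]
  show "\<Gamma>' x = \<Gamma> x"
  proof (cases "x \<in> dom V")
    case True
    with assms have "the (\<Gamma>' x) = the (\<Gamma> x)"
      unfolding assignment_typing_def by (metis val_typing_unique)
    then show ?thesis using True d by (metis domD option.sel)
  next
    case False
    then show ?thesis using d by (metis domIff)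
  qed
qed

text \<open>Injectivity is demanded on all of \<open>Q\<close>, since pointers of different
  variables must stay apart as well.\<close>

lemma assignment_typing_reindex:
  assumes "assignment_typing Q \<Gamma> V" and inj: "inj_on (reindex_ptr P) Q"
  shows "assignment_typing (reindex_ptr P ` Q) \<Gamma> (reindex_all P V)"
proof -
  from assms(1) obtain R where dom: "dom V = dom \<Gamma>"
    and R: "\<forall>y \<in> dom V. val_typing (R y) (the (V y)) (the (\<Gamma> y))"
      "disjoint_family_on R (dom V)" "Q = (\<Union>y \<in> dom V. R y)"
    by (auto simp: assignment_typing_def)
  let ?R = "\<lambda>y. reindex_ptr P ` R y"
  have dom': "dom (reindex_all P V) = dom V" by (auto simp: reindex_all_def)
  have "val_typing (?R y) (the (reindex_all P V y)) (the (\<Gamma> y))" if "y \<in> dom V" for y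
  proof -
    have "inj_on (reindex_ptr P) (R y)" using inj R(3) that by (blast intro: inj_on_subset)
    then have "val_typing (?R y) (reindex P (the (V y))) (the (\<Gamma> y))"
      using val_typing_reindex R(1) that by blast
    then show ?thesis using that by (auto simp: reindex_all_def)
  qed
  moreover have "disjoint_family_on ?R (dom V)"
    unfolding disjoint_family_on_def
  proof (intro ballI impI)
    fix y z assume yz: "y \<in> dom V" "z \<in> dom V" "y \<noteq> z"
    then have "?R y \<inter> ?R z = reindex_ptr P ` (R y \<inter> R z)"
      using R(3) by (intro inj_on_image_Int[OF inj, symmetric]) auto
    then show "?R y \<inter> ?R z = {}" using R(2) yz by (simp add: disjoint_family_on_def)
  qed
  ultimately show ?thesis
    unfolding assignment_typing_def dom' using dom R(3)
    by (intro conjI exI[of _ ?R]) (auto simp: image_UN)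
qed

section \<open>Procedure stores\<close>

lemma store_typing_dom: "store_typing \<Phi> \<Omega> \<Longrightarrow> dom \<Phi> = def_name ` \<Omega>"
  by (induction rule: store_typing.induct) simp_all

text \<open>A body is checked in the context in force when its procedure enters the store. Later
  names are fresh, so weakening carries the typing to the full context, as a call requires.\<close>

lemma store_typing_lookup:
  "\<lbrakk>store_typing \<Phi> \<Omega>; ProcDef f x A y B M \<in> \<Omega>\<rbrakk>
    \<Longrightarrow> \<Phi> f = Some (A, B) \<and> typing \<Phi> [x \<mapsto> A] M [y \<mapsto> B]"
proof (induction arbitrary: f x A y B M rule: store_typing.induct)
  case (extend \<Phi> \<Omega> g C D z N w)
  show ?case
  proof (cases "ProcDef f x A y B M \<in> \<Omega>")
    case True
    then have IH: "\<Phi> f = Some (A, B)" "typing \<Phi> [x \<mapsto> A] M [y \<mapsto> B]" using extend.IH by blast+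
    have "g \<notin> dom \<Phi>" using extend.hyps store_typing_dom by blast
    then have "\<Phi> \<subseteq>\<^sub>m \<Phi>(g \<mapsto> (C, D))" "(\<Phi>(g \<mapsto> (C, D))) f = Some (A, B)"
      using IH(1) by (auto simp: map_le_def fun_upd_apply)
    moreover have "wf_pctx (\<Phi>(g \<mapsto> (C, D)))" using extend.hyps typing_wf by blast
    ultimately show ?thesis using typing_weaken[OF IH(2)] by blast
  next
    case False
    then show ?thesis using extend by auto
  qed
qed simp

lemma store_typing_lookup_converse:
  "\<lbrakk>store_typing \<Phi> \<Omega>; \<Phi> f = Some (A, B)\<rbrakk> \<Longrightarrow> \<exists>x y M. ProcDef f x A y B M \<in> \<Omega>"
  by (induction arbitrary: f A B rule: store_typing.induct) (fastforce simp: fun_upd_apply split: if_splits)+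

text \<open>A store is a set and forgets the order of its definitions, but each entry of the context
  can be read off from a definition and conversely.\<close>

lemma store_typing_unique:
  assumes "store_typing \<Phi> \<Omega>" "store_typing \<Phi>' \<Omega>"
  shows "\<Phi>' = \<Phi>"
proof -
  have "\<Phi>' f = Some C \<longleftrightarrow> \<Phi> f = Some C" for f C
    using assms store_typing_lookup store_typing_lookup_converse by (cases C) metis
  then show ?thesis by (intro ext) (metis not_None_eq)
qed

section \<open>Preservation\<close>

lemma config_typing_iff:
  "config_typing \<Phi> \<Gamma> \<Sigma> Q (M, V, \<Omega>, \<rho>) \<longleftrightarrow> typing \<Phi> \<Gamma> M \<Sigma> \<and>
    assignment_typing {1..qdim \<rho>} \<Gamma> V \<and> store_typing \<Phi> \<Omega> \<and> qstate \<rho> \<and> Q = {1..qdim \<rho>}"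
  by auto

lemma config_typingD:
  assumes "config_typing \<Phi> \<Gamma> \<Sigma> Q (M, V, \<Omega>, \<rho>)"
  shows "typing \<Phi> \<Gamma> M \<Sigma>" "assignment_typing {1..qdim \<rho>} \<Gamma> V" "store_typing \<Phi> \<Omega>" "qstate \<rho>"
  using assms unfolding config_typing_iff by blast+

text \<open>The procedure context is read off the store, the variable context off the assigned
  values, and the pointer set off the dimension of the state.\<close>

lemma config_typing_unique:
  assumes "config_typing \<Phi> \<Gamma> \<Sigma> Q c" "config_typing \<Phi>' \<Gamma>' \<Sigma>' Q' c"
  shows "\<Phi>' = \<Phi> \<and> \<Gamma>' = \<Gamma> \<and> Q' = Q"
proof (cases c)
  case (fields M V \<Omega> \<rho>)
  with assms show ?thesis
    unfolding fields config_typing_iff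
    using assignment_typing_unique store_typing_unique by blast
qed

section \<open>Preservation for single reduction steps\<close>

inductive_cases typing_elims:
  "typing \<Phi> \<Gamma> (NewUnit u) \<Sigma>" "typing \<Phi> \<Gamma> (Discard x) \<Sigma>" "typing \<Phi> \<Gamma> (Copy y x) \<Sigma>"
  "typing \<Phi> \<Gamma> (NewQbit q) \<Sigma>" "typing \<Phi> \<Gamma> (Measure b q) \<Sigma>" "typing \<Phi> \<Gamma> (Gate qs S) \<Sigma>"
  "typing \<Phi> \<Gamma> (Seq M N) \<Sigma>" "typing \<Phi> \<Gamma> Skip \<Sigma>" "typing \<Phi> \<Gamma> (While b M) \<Sigma>"
  "typing \<Phi> \<Gamma> (Left A B y x) \<Sigma>" "typing \<Phi> \<Gamma> (Right A B y x) \<Sigma>"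
  "typing \<Phi> \<Gamma> (Case y x1 M1 x2 M2) \<Sigma>" "typing \<Phi> \<Gamma> (Pair x x1 x2) \<Sigma>"
  "typing \<Phi> \<Gamma> (Unpair x1 x2 x) \<Sigma>" "typing \<Phi> \<Gamma> (Fold A y x) \<Sigma>" "typing \<Phi> \<Gamma> (Unfold y x) \<Sigma>"
  "typing \<Phi> \<Gamma> (Proc f x A y B M) \<Sigma>" "typing \<Phi> \<Gamma> (Call y f x) \<Sigma>"

text \<open>The condition \<open>\<Phi> \<subseteq>\<^sub>m \<Phi>'\<close> keeps the continuation \<open>N\<close> of a sequence \<open>M; N\<close> typable.\<close>

definition step_typable :: "pctx \<Rightarrow> vctx \<Rightarrow> config \<Rightarrow> bool" where
  "step_typable \<Phi> \<Sigma> c \<longleftrightarrow> (\<exists>\<Phi>' \<Gamma>' Q'. \<Phi> \<subseteq>\<^sub>m \<Phi>' \<and> config_typing \<Phi>' \<Gamma>' \<Sigma> Q' c)"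

lemma step_typableI:
  "\<lbrakk>typing \<Phi> \<Gamma> M \<Sigma>; store_typing \<Phi> \<Omega>; qstate \<rho>; assignment_typing {1..qdim \<rho>} \<Gamma> V\<rbrakk>
    \<Longrightarrow> step_typable \<Phi> \<Sigma> (M, V, \<Omega>, \<rho>)"
  unfolding step_typable_def config_typing_iff by (metis map_le_refl)

text \<open>Serves the rules that end in \<open>Skip\<close> and leave the procedure context alone.
  The typing of the old term \<open>M\<close> provides the well-formedness of \<Sigma>.\<close>

lemma step_typable_Skip:
  "\<lbrakk>typing \<Phi> \<Gamma> M \<Sigma>; store_typing \<Phi> \<Omega>; qstate \<rho>; assignment_typing {1..qdim \<rho>} \<Sigma> V\<rbrakk>
    \<Longrightarrow> step_typable \<Phi> \<Sigma> (Skip, V, \<Omega>, \<rho>)"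
  by (rule step_typableI[where \<Gamma> = \<Sigma>]) (auto simp: wf_ctxs_def intro!: typing.Skip dest: typing_wf)

text \<open>The new value has the same pointers as the old one, so the partition of \<open>Q\<close>
  is unchanged.\<close>

lemma assignment_typing_replace:
  assumes "assignment_typing Q (\<Gamma>(x \<mapsto> A)) (V(x \<mapsto> v))" "x \<notin> dom \<Gamma>" "x \<notin> dom V" "y \<notin> dom \<Gamma>"
    and "\<And>Q1. val_typing Q1 v A \<Longrightarrow> val_typing Q1 w B"
  shows "assignment_typing Q (\<Gamma>(y \<mapsto> B)) (V(y \<mapsto> w))"
  using assms by (metis assignment_typing_updE assignment_typing_updI)

text \<open>A variable holding a pointer owns exactly that singleton, and distinct variables own
  disjoint sets. So a gate never acts on one qubit twice.\<close>

lemma assignment_typing_ptrs: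
  assumes "assignment_typing Q \<Gamma> V" "distinct qs" "list_all2 (\<lambda>q m. V q = Some (VPtr m)) qs ms"
  shows "distinct ms" "set ms \<subseteq> Q"
proof -
  from assms(1) obtain R where R: "\<forall>x \<in> dom V. val_typing (R x) (the (V x)) (the (\<Gamma> x))"
      "disjoint_family_on R (dom V)" "Q = (\<Union>x \<in> dom V. R x)"
    by (auto simp: assignment_typing_def)
  have len: "length qs = length ms" using assms(3) by (rule list_all2_lengthD)
  have V: "V (qs ! i) = Some (VPtr (ms ! i))" if "i < length ms" for i
    using list_all2_nthD[OF assms(3)] that len by simp
  have Ri: "R (qs ! i) = {ms ! i}" if "i < length ms" for i
  proof -
    have "qs ! i \<in> dom V" using V[OF that] by blast
    then have "val_typing (R (qs ! i)) (VPtr (ms ! i)) (the (\<Gamma> (qs ! i)))"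
      using bspec[OF R(1)] V[OF that] by fastforce
    then show ?thesis by (rule val_typing_elims)
  qed
  show "distinct ms"
  proof (unfold distinct_conv_nth, intro allI impI)
    fix i j assume ij: "i < length ms" "j < length ms" "i \<noteq> j"
    then have "qs ! i \<noteq> qs ! j" using assms(2) len by (simp add: nth_eq_iff_index_eq)
    then have "R (qs ! i) \<inter> R (qs ! j) = {}"
      using V ij by (intro disjoint_family_onD[OF R(2)]) blast+
    then show "ms ! i \<noteq> ms ! j" using Ri ij by auto
  qed
  show "set ms \<subseteq> Q"
  proof
    fix m assume "m \<in> set ms"
    then obtain i where i: "i < length ms" "ms ! i = m" by (auto simp: in_set_conv_nth)
    then have "qs ! i \<in> dom V" "m \<in> R (qs ! i)" using V Ri by auto
    then show "m \<in> Q" using R(3) by blast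
  qed
qed

text \<open>By uniqueness \<open>P\<close> is the share of \<open>v\<close>; the remaining variables
  own \<open>{1..N} - P\<close>, which the renumbering maps onto an initial segment.\<close>

lemma assignment_typing_remove:
  assumes "assignment_typing {1..N} (\<Gamma>(x \<mapsto> A)) (V(x \<mapsto> v))" "x \<notin> dom \<Gamma>" "x \<notin> dom V"
    and "val_typing P v B"
  shows "P \<subseteq> {1..N}" "assignment_typing {1..N - card P} \<Gamma> (reindex_all P V)"
proof -
  obtain Q1 Q2 where Q: "val_typing Q1 v A" "assignment_typing Q2 \<Gamma> V"
      "Q1 \<inter> Q2 = {}" "{1..N} = Q1 \<union> Q2"
    using assignment_typing_updE[OF assms(1-3)] by metis
  have "Q1 = P" using val_typing_unique[OF assms(4) Q(1)] by simp
  with Q(3,4) show P: "P \<subseteq> {1..N}" by blast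
  have "Q2 = {1..N} - P" using Q(3,4) \<open>Q1 = P\<close> by blast
  then show "assignment_typing {1..N - card P} \<Gamma> (reindex_all P V)"
    using assignment_typing_reindex[of "{1..N} - P" \<Gamma> V P] Q(2) reindex_ptr_bij[OF P] by simp
qed

text \<open>Treats both outcomes at once: the resulting bit \<open>w\<close> owns no qubit, and
  measuring removes the single pointer \<open>m\<close>.\<close>

lemma step_typable_measure:
  assumes "config_typing \<Phi> \<Gamma> \<Sigma> Q (Measure b q, V(q \<mapsto> VPtr m), \<Omega>, \<rho>)"
    and "q \<notin> dom V" "i < 2" "val_typing {} w bit_ty"
  shows "step_typable \<Phi> \<Sigma> (Skip, (reindex_all {m} V)(b \<mapsto> w), \<Omega>, project m i \<rho>)"
proof -
  note C = config_typingD[OF assms(1)]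
  from C(1) obtain G where G: "\<Gamma> = G(q \<mapsto> Qbit)" "\<Sigma> = G(b \<mapsto> bit_ty)" "q \<notin> dom G" "b \<notin> dom G"
    by (rule typing_elims) blast
  note R = assignment_typing_remove[OF C(2)[unfolded G(1)] G(3) assms(2) val_typing.VPtr]
  have m: "m \<in> {1..qdim \<rho>}" using R(1) by blast
  have "assignment_typing {1..qdim (project m i \<rho>)} \<Sigma> ((reindex_all {m} V)(b \<mapsto> w))"
    unfolding G(2) using assignment_typing_updI[OF R(2) assms(4) _ G(4)] qstate_project(2)[OF C(4) m assms(3)]
    by simp
  with C qstate_project(1)[OF C(4) m assms(3)] show ?thesis by (blast intro: step_typable_Skip)
qed

text \<open>The frame consists of the caller's variables other than the argument; the renamed body
  runs alongside it.\<close>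

lemma typing_call:
  assumes body: "typing \<Phi> [x2 \<mapsto> A] M [y2 \<mapsto> B]"
    and \<Gamma>: "wf_vctx \<Gamma>" "x1 \<notin> dom \<Gamma>" "y1 \<notin> dom \<Gamma>"
    and \<sigma>: "\<sigma> x2 = x1" "\<sigma> y2 = y1" "inj_on \<sigma> (vars M \<union> {x2, y2})"
      "\<forall>z \<in> vars M - {x2, y2}. \<sigma> z \<notin> dom \<Gamma>"
  shows "typing \<Phi> (\<Gamma>(x1 \<mapsto> A)) (rename \<sigma> M) (\<Gamma>(y1 \<mapsto> B))"
proof -
  let ?W = "vars M \<union> {x2, y2}"
  have "\<forall>z \<in> ?W. \<sigma> z \<notin> dom \<Gamma>" using \<Gamma> \<sigma> by blast
  then have "rename_ctx \<sigma> ?W \<Gamma> Map.empty = \<Gamma>" by (rule rename_ctx_empty)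
  moreover have "typing \<Phi> (rename_ctx \<sigma> ?W \<Gamma> [x2 \<mapsto> A]) (rename \<sigma> M) (rename_ctx \<sigma> ?W \<Gamma> [y2 \<mapsto> B])"
    using typing_rename[OF body _ \<sigma>(3) \<Gamma>(1)] by blast
  ultimately show ?thesis using \<sigma>(1-3) by simp
qed

theorem preservation:
  "\<lbrakk>c \<leadsto> c'; config_typing \<Phi> \<Gamma> \<Sigma> Q c\<rbrakk> \<Longrightarrow> step_typable \<Phi> \<Sigma> c'"
proof (induction arbitrary: \<Phi> \<Gamma> \<Sigma> Q rule: reduces.induct)
  case (unit u V \<Omega> \<rho>)
  note C = config_typingD[OF unit.prems]
  from C(1) have G: "\<Sigma> = \<Gamma>(u \<mapsto> One)" "u \<notin> dom \<Gamma>" by (rule typing_elims, blast)+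
  have "assignment_typing {1..qdim \<rho>} \<Sigma> (V(u \<mapsto> VUnit))"
    unfolding G(1) using assignment_typing_updI[OF C(2) val_typing.VUnit _ G(2)] by simp
  with C show ?case by (blast intro: step_typable_Skip)
next
  case (discard x V Qv v A \<Omega> \<rho>)
  note C = config_typingD[OF discard.prems]
  from C(1) obtain A' where G: "\<Gamma> = \<Sigma>(x \<mapsto> A')" "x \<notin> dom \<Sigma>" by (rule typing_elims) blast
  note R = assignment_typing_remove[OF C(2)[unfolded G(1)] G(2) discard.hyps]
  have "assignment_typing {1..qdim (ptrace Qv \<rho>)} \<Sigma> (reindex_all Qv V)"
    using R(2) qstate_ptrace(2)[OF C(4) R(1)] by simp
  with C qstate_ptrace(1)[OF C(4) R(1)] show ?case by (blast intro: step_typable_Skip)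
next
  case (copy x V y v \<Omega> \<rho>)
  note C = config_typingD[OF copy.prems]
  from C(1) obtain G P where G: "\<Gamma> = G(x \<mapsto> P)" "\<Sigma> = G(x \<mapsto> P, y \<mapsto> P)"
    "x \<notin> dom G" "y \<noteq> x" "y \<notin> dom G" "classical P"
    by (rule typing_elims) blast
  then have y: "y \<notin> dom (G(x \<mapsto> P))" by simp
  have a: "assignment_typing {1..qdim \<rho>} (G(x \<mapsto> P)) (V(x \<mapsto> v))" using C(2) unfolding G(1) .
  obtain Q1 where "val_typing Q1 v P"
    using assignment_typing_updE[OF a G(3) copy.hyps(1)] by blast
  \<comment> \<open>The value owns no qubits, so both copies can coexist with disjoint pointer
    sets.\<close>
  with G(6) have v: "val_typing {} v P" using val_typing_classical by blast
  have "assignment_typing {1..qdim \<rho>} \<Sigma> (V(x \<mapsto> v, y \<mapsto> v))"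
    unfolding G(2) using assignment_typing_updI[OF a v _ y] by simp
  with C show ?case by (blast intro: step_typable_Skip)
next
  case (qbit q V \<Omega> \<rho>)
  note C = config_typingD[OF qbit.prems]
  from C(1) have G: "\<Sigma> = \<Gamma>(q \<mapsto> Qbit)" "q \<notin> dom \<Gamma>" by (rule typing_elims, blast)+
  have "assignment_typing ({qdim \<rho> + 1} \<union> {1..qdim \<rho>}) \<Sigma> (V(q \<mapsto> VPtr (qdim \<rho> + 1)))"
    unfolding G(1) using assignment_typing_updI[OF C(2) val_typing.VPtr _ G(2)] by simp
  moreover have "{qdim \<rho> + 1} \<union> {1..qdim \<rho>} = {1..qdim (add_qubit \<rho>)}"
    unfolding qstate_add_qubit(2)[OF C(4)] by auto
  ultimately show ?case
    using C qstate_add_qubit(1)[OF C(4)] by (simp only:) (blast intro: step_typable_Skip)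
next
  case (gate qs V ms S \<Omega> \<rho>)
  note C = config_typingD[OF gate.prems]
  from C(1) have G: "\<Sigma> = \<Gamma>" "unitary_mat (2 ^ length qs) S" by (rule typing_elims, blast)+
  have "length qs = length ms" using gate.hyps(2) by (rule list_all2_lengthD)
  with G(2) have S: "unitary_mat (2 ^ length ms) S" by simp
  note A = qstate_apply_gate[OF C(4) S assignment_typing_ptrs[OF C(2) gate.hyps]]
  have "assignment_typing {1..qdim (apply_gate ms S \<rho>)} \<Sigma> V" using C(2) G(1) A(2) by simp
  with C A(1) show ?case by (blast intro: step_typable_Skip)
next
  case (measure0 q V b m \<Omega> \<rho>)
  show ?case
    using measure0.prems measure0.hyps(1)
    by (rule step_typable_measure) (auto intro: val_typing.intros)
next
  case (measure1 q V b m \<Omega> \<rho>)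
  show ?case
    using measure1.prems measure1.hyps(1)
    by (rule step_typable_measure) (auto intro: val_typing.intros)
next
  case (seq1 N V \<Omega> \<rho>)
  note C = config_typingD[OF seq1.prems]
  from C(1) obtain G where G: "typing \<Phi> \<Gamma> Skip G" "typing \<Phi> G N \<Sigma>" by (rule typing_elims)
  from G(1) have "G = \<Gamma>" by (rule typing_elims)
  with G(2) C show ?case by (blast intro: step_typableI)
next
  case (seq2 M V \<Omega> \<rho> M' V' \<Omega>' \<rho>' N)
  note C = config_typingD[OF seq2.prems]
  from C(1) obtain G where G: "typing \<Phi> \<Gamma> M G" "typing \<Phi> G N \<Sigma>" by (rule typing_elims)
  have "config_typing \<Phi> \<Gamma> G Q (M, V, \<Omega>, \<rho>)" using seq2.prems G(1) unfolding config_typing.simps by blast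
  then obtain \<Phi>' \<Gamma>' Q' where D: "\<Phi> \<subseteq>\<^sub>m \<Phi>'" "config_typing \<Phi>' \<Gamma>' G Q' (M', V', \<Omega>', \<rho>')"
    using seq2.IH unfolding step_typable_def by blast
  have "typing \<Phi>' \<Gamma>' M' G" using D(2) unfolding config_typing.simps by blast
  \<comment> \<open>The first component may have added a procedure, so the continuation is retyped
    in the larger context.\<close>
  moreover from this have "typing \<Phi>' G N \<Sigma>" using typing_weaken[OF G(2) D(1)] typing_wf by blast
  ultimately have "config_typing \<Phi>' \<Gamma>' \<Sigma> Q' (Seq M' N, V', \<Omega>', \<rho>')"
    using D(2) typing.Seq unfolding config_typing.simps by blast
  then show ?case using D(1) unfolding step_typable_def by blast
next
  case (while b V u M \<Omega> \<rho>)
  note C = config_typingD[OF while.prems]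
  from C(1) obtain G where G: "\<Gamma> = G(b \<mapsto> bit_ty)" "\<Sigma> = \<Gamma>" "b \<notin> dom G"
    "typing \<Phi> (G(b \<mapsto> bit_ty)) M (G(b \<mapsto> bit_ty))"
    by (rule typing_elims) blast
  have "u \<notin> dom G" using while.hyps(2) assignment_typing_dom[OF C(2)] G(1) by simp
  have wf: "wf_ctxs \<Phi> G" using typing_wf[OF G(4)] G(3) by (simp add: wf_ctxs_def)
  \<comment> \<open>Both branches rebuild \<open>b\<close> from \<open>u\<close>, restoring the
    context of the loop; the inner copy of the loop is typed by the \<open>While\<close> rule
    again.\<close>
  have "typing \<Phi> (G(b \<mapsto> bit_ty)) (Seq M (While b M)) (G(b \<mapsto> bit_ty))"
    using G(4) typing.While[OF G(3,4)] by (rule typing.Seq)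
  moreover have "typing \<Phi> (G(u \<mapsto> One)) (Right One One b u) (G(b \<mapsto> bit_ty))"
    "typing \<Phi> (G(u \<mapsto> One)) (Left One One b u) (G(b \<mapsto> bit_ty))"
    using typing.Right[OF wf \<open>u \<notin> dom G\<close> G(3)] typing.Left[OF wf \<open>u \<notin> dom G\<close> G(3)] by simp_all
  ultimately have "typing \<Phi> \<Gamma> (if_then u b (Seq M (While b M))) \<Sigma>"
    unfolding G(1,2) if_then_def
    using typing.Case[OF G(3) \<open>u \<notin> dom G\<close> \<open>u \<notin> dom G\<close>] typing.Seq by blast
  with C show ?case by (blast intro: step_typableI)
next
  case (left x V y A B v \<Omega> \<rho>)
  note C = config_typingD[OF left.prems]
  from C(1) obtain G where G: "\<Gamma> = G(x \<mapsto> A)" "\<Sigma> = G(y \<mapsto> Sum A B)" "x \<notin> dom G" "y \<notin> dom G"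
    by (rule typing_elims) blast
  have "assignment_typing {1..qdim \<rho>} \<Sigma> (V(y \<mapsto> VLeft A B v))"
    unfolding G(2) using C(2)[unfolded G(1)] G(3) left.hyps(1) G(4) val_typing.VLeft
    by (rule assignment_typing_replace)
  with C show ?case by (blast intro: step_typable_Skip)
next
  case (right x V y A B v \<Omega> \<rho>)
  note C = config_typingD[OF right.prems]
  from C(1) obtain G where G: "\<Gamma> = G(x \<mapsto> B)" "\<Sigma> = G(y \<mapsto> Sum A B)" "x \<notin> dom G" "y \<notin> dom G"
    by (rule typing_elims) blast
  have "assignment_typing {1..qdim \<rho>} \<Sigma> (V(y \<mapsto> VRight A B v))"
    unfolding G(2) using C(2)[unfolded G(1)] G(3) right.hyps(1) G(4) val_typing.VRight
    by (rule assignment_typing_replace)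
  with C show ?case by (blast intro: step_typable_Skip)
next
  case (case_left y V x1 M1 x2 M2 A B v \<Omega> \<rho>)
  note C = config_typingD[OF case_left.prems]
  from C(1) obtain G A' B' where G: "\<Gamma> = G(y \<mapsto> Sum A' B')" "y \<notin> dom G" "x1 \<notin> dom G"
    "typing \<Phi> (G(x1 \<mapsto> A')) M1 \<Sigma>"
    by (rule typing_elims) blast
  \<comment> \<open>The annotations in the value need not be assumed to match the context: inverting
    the typing of the value identifies them.\<close>
  have "assignment_typing {1..qdim \<rho>} (G(x1 \<mapsto> A')) (V(x1 \<mapsto> v))"
    using C(2)[unfolded G(1)] G(2) case_left.hyps(1) G(3)
    by (rule assignment_typing_replace) (blast elim: val_typing_elims)
  with C G(4) show ?case by (blast intro: step_typableI)
next
  case (case_right y V x2 x1 M1 M2 A B v \<Omega> \<rho>)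
  note C = config_typingD[OF case_right.prems]
  from C(1) obtain G A' B' where G: "\<Gamma> = G(y \<mapsto> Sum A' B')" "y \<notin> dom G" "x2 \<notin> dom G"
    "typing \<Phi> (G(x2 \<mapsto> B')) M2 \<Sigma>"
    by (rule typing_elims) blast
  have "assignment_typing {1..qdim \<rho>} (G(x2 \<mapsto> B')) (V(x2 \<mapsto> v))"
    using C(2)[unfolded G(1)] G(2) case_right.hyps(1) G(3)
    by (rule assignment_typing_replace) (blast elim: val_typing_elims)
  with C G(4) show ?case by (blast intro: step_typableI)
next
  case (pair x1 V x2 v1 x v2 \<Omega> \<rho>)
  note C = config_typingD[OF pair.prems]
  from C(1) obtain G A B where G: "\<Gamma> = G(x1 \<mapsto> A, x2 \<mapsto> B)" "\<Sigma> = G(x \<mapsto> Tensor A B)"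
    "x1 \<notin> dom G" "x \<notin> dom G" "x2 \<noteq> x1" "x2 \<notin> dom G"
    by (rule typing_elims) blast
  then have x2: "x2 \<notin> dom (G(x1 \<mapsto> A))" by simp
  \<comment> \<open>The components are removed in reverse order of the updates; their shares are
    then merged into that of the pair.\<close>
  obtain Q2 Q' where Q2: "val_typing Q2 v2 B" "assignment_typing Q' (G(x1 \<mapsto> A)) (V(x1 \<mapsto> v1))"
    "Q2 \<inter> Q' = {}" "{1..qdim \<rho>} = Q2 \<union> Q'"
    using assignment_typing_updE[OF C(2)[unfolded G(1)] x2 pair.hyps(2)] by metis
  obtain Q1 Q0 where Q1: "val_typing Q1 v1 A" "assignment_typing Q0 G V"
    "Q1 \<inter> Q0 = {}" "Q' = Q1 \<union> Q0"
    using assignment_typing_updE[OF Q2(2) G(3) pair.hyps(1)] by metis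
  have "val_typing (Q1 \<union> Q2) (VPair v1 v2) (Tensor A B)"
    using Q1 Q2 by (intro val_typing.VPair) auto
  then have "assignment_typing (Q1 \<union> Q2 \<union> Q0) \<Sigma> (V(x \<mapsto> VPair v1 v2))"
    unfolding G(2) using Q1 Q2 G(4) by (intro assignment_typing_updI) auto
  moreover have "Q1 \<union> Q2 \<union> Q0 = {1..qdim \<rho>}" using Q1(4) Q2(4) by blast
  ultimately show ?case using C by (simp only:) (blast intro: step_typable_Skip)
next
  case (unpair x V x1 x2 v1 v2 \<Omega> \<rho>)
  note C = config_typingD[OF unpair.prems]
  from C(1) obtain G A B where G: "\<Gamma> = G(x \<mapsto> Tensor A B)" "\<Sigma> = G(x1 \<mapsto> A, x2 \<mapsto> B)"
    "x1 \<notin> dom G" "x \<notin> dom G" "x2 \<noteq> x1" "x2 \<notin> dom G"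
    by (rule typing_elims) blast
  then have x2: "x2 \<notin> dom (G(x1 \<mapsto> A))" by simp
  obtain Q' Q0 where Q': "val_typing Q' (VPair v1 v2) (Tensor A B)" "assignment_typing Q0 G V"
    "Q' \<inter> Q0 = {}" "{1..qdim \<rho>} = Q' \<union> Q0"
    using assignment_typing_updE[OF C(2)[unfolded G(1)] G(4) unpair.hyps(1)] by metis
  obtain Q1 Q2 where Q: "val_typing Q1 v1 A" "val_typing Q2 v2 B" "Q1 \<inter> Q2 = {}" "Q' = Q1 \<union> Q2"
    using Q'(1) by (rule val_typing_elims) blast
  have "assignment_typing (Q1 \<union> Q0) (G(x1 \<mapsto> A)) (V(x1 \<mapsto> v1))"
    using Q Q' G(3) by (intro assignment_typing_updI) auto
  moreover have "Q2 \<inter> (Q1 \<union> Q0) = {}" using Q(3,4) Q'(3) by blast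
  ultimately have "assignment_typing (Q2 \<union> (Q1 \<union> Q0)) \<Sigma> (V(x1 \<mapsto> v1, x2 \<mapsto> v2))"
    unfolding G(2) using assignment_typing_updI[OF _ Q(2) _ x2] by blast
  moreover have "Q2 \<union> (Q1 \<union> Q0) = {1..qdim \<rho>}" using Q(4) Q'(4) by blast
  ultimately show ?case using C by (simp only:) (blast intro: step_typable_Skip)
next
  case (fold x V y A v \<Omega> \<rho>)
  note C = config_typingD[OF fold.prems]
  from C(1) obtain G where G: "\<Gamma> = G(x \<mapsto> unroll A)" "\<Sigma> = G(y \<mapsto> Mu A)" "x \<notin> dom G" "y \<notin> dom G"
    by (rule typing_elims) blast
  have "assignment_typing {1..qdim \<rho>} \<Sigma> (V(y \<mapsto> VFold A v))"
    unfolding G(2) using C(2)[unfolded G(1)] G(3) fold.hyps(1) G(4) val_typing.VFold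
    by (rule assignment_typing_replace)
  with C show ?case by (blast intro: step_typable_Skip)
next
  case (unfold x V y A v \<Omega> \<rho>)
  note C = config_typingD[OF unfold.prems]
  from C(1) obtain G A' where G: "\<Gamma> = G(x \<mapsto> Mu A')" "\<Sigma> = G(y \<mapsto> unroll A')"
    "x \<notin> dom G" "y \<notin> dom G"
    by (rule typing_elims) blast
  have "assignment_typing {1..qdim \<rho>} \<Sigma> (V(y \<mapsto> v))"
    unfolding G(2) using C(2)[unfolded G(1)] G(3) unfold.hyps(1) G(4)
    by (rule assignment_typing_replace) (blast elim: val_typing_elims)
  with C show ?case by (blast intro: step_typable_Skip)
next
  case (procedure f \<Omega> x A y B M V \<rho>)
  note C = config_typingD[OF procedure.prems]
  let ?\<Phi> = "\<Phi>(f \<mapsto> (A, B))"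
  from C(1) have G: "\<Sigma> = \<Gamma>" "typing ?\<Phi> [x \<mapsto> A] M [y \<mapsto> B]" by (rule typing_elims, blast)+
  \<comment> \<open>Freshness in the store is freshness in the context, so the update is a genuine
    extension.\<close>
  have "f \<notin> dom \<Phi>" using procedure.hyps store_typing_dom[OF C(3)] by simp
  then have "\<Phi> \<subseteq>\<^sub>m ?\<Phi>" by (auto simp: map_le_def fun_upd_apply)
  moreover have "store_typing ?\<Phi> (insert (ProcDef f x A y B M) \<Omega>)"
    using C(3) procedure.hyps G(2) by (rule store_typing.extend)
  moreover have "typing ?\<Phi> \<Gamma> Skip \<Sigma>"
    unfolding G(1) using typing_wf[OF C(1)] typing_wf[OF G(2)] by (simp add: typing.Skip wf_ctxs_def)
  ultimately show ?case using C unfolding step_typable_def config_typing_iff by blast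
next
  case (call x1 V f x2 A y2 B M \<Omega> \<sigma> y1 \<rho>)
  note C = config_typingD[OF call.prems]
  from C(1) obtain G A' B' where G: "\<Gamma> = G(x1 \<mapsto> A')" "\<Sigma> = G(y1 \<mapsto> B')" "\<Phi> f = Some (A', B')"
    "x1 \<notin> dom G" "y1 \<notin> dom G" "wf_ctxs \<Phi> G"
    by (rule typing_elims) blast
  note body = store_typing_lookup[OF C(3) call.hyps(2)]
  have AB: "A' = A" "B' = B" using G(3) body by simp_all
  \<comment> \<open>The call rule chooses names fresh for the whole assignment, hence for the
    frame.\<close>
  have "dom G \<subseteq> dom V" using assignment_typing_dom[OF C(2)] G(1) by auto
  then have "\<forall>z \<in> vars M - {x2, y2}. \<sigma> z \<notin> dom G" using call.hyps(6) by blast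
  with body G call.hyps(3-5) have "typing \<Phi> \<Gamma> (rename \<sigma> M) \<Sigma>"
    unfolding G(1,2) AB wf_ctxs_def by (intro typing_call) auto
  with C show ?case by (blast intro: step_typableI)
qed

theorem theorem1:
  assumes "config_typing \<Phi> \<Gamma> \<Sigma> Q (M, V, \<Omega>, \<rho>)"
    and "(M, V, \<Omega>, \<rho>) \<leadsto> (M', V', \<Omega>', \<rho>')"
  shows "\<exists>\<Phi>' \<Gamma>' Q'. config_typing \<Phi>' \<Gamma>' \<Sigma> Q' (M', V', \<Omega>', \<rho>')
    \<and> (\<forall>\<Phi>'' \<Gamma>'' Q''. config_typing \<Phi>'' \<Gamma>'' \<Sigma> Q'' (M', V', \<Omega>', \<rho>')
          \<longrightarrow> \<Phi>'' = \<Phi>' \<and> \<Gamma>'' = \<Gamma>' \<and> Q'' = Q')"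
proof -
  obtain \<Phi>' \<Gamma>' Q' where "config_typing \<Phi>' \<Gamma>' \<Sigma> Q' (M', V', \<Omega>', \<rho>')"
    using preservation[OF assms(2,1)] unfolding step_typable_def by blast
  then show ?thesis using config_typing_unique by blast
qed

end
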